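(* Let $\Omega$, $m$, $H$, $\omega$, $q$, $\alpha$, $\tau$ satisfy the assumptions in the context, with $a,\rho,\bar a,v_I$ as defined there, and let $r$ be an integer with $1\le r<q-\tau-N$. Then for each $I\in\Omega$ the conjugacy $\phi=\Psi_I(\theta):=\theta+\omega(I)\,v_I(\theta)$ is a $C^r$ diffeomorphism of $\mathbb{T}^N$ such that the new angular variables form a constant-speed linear flow with frequency $\bar a\,\omega(I)$ (that is, if $\dot\theta=a(\theta)\,\omega(I)$ then $\phi=\Psi_I(\theta)$ satisfies $\dot\phi=\bar a\,\omega(I)$), and the pushforward measure $\nu_I:=(\Psi_I)_{\#}\big(\rho(\theta)\,\mathrm{d}\theta\big)$ satisfies $\nu_I=\bar a^{-1}\,\mathrm{d}\phi$, i.e. it is a constant multiple of the Lebesgue measure on $\mathbb{T}^N$.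
   Context: $\mathbb{T}^N=(\mathbb{R}/2\pi\mathbb{Z})^N$; $\Omega\subset\mathbb{R}^N$ is a bounded Lipschitz domain; $H=H(I)\in C^2(\Omega)$, $\omega(I)=\nabla_I H(I)$; $m\in C^q(\mathbb{T}^N)$ with $m>0$, where $q$ is an integer with $q>2N$ and $q\ge\tau+N+1$. Nonresonance: $\alpha>0$ and $2(N-1)<2\tau\le q-N-1$ are such that $|n\cdot\omega(I)|\ge\alpha|n|^{-\tau}$ for all $I\in\Omega$ and all $n\in\mathbb{Z}^N\setminus\{0\}$. Put $a(\theta)=m(\theta)^{-1/N}$, $\rho(\theta)=m(\theta)^{1/N}$, $\bar a=(2\pi)^N/\int_{\mathbb{T}^N}\rho(\theta)\,\mathrm{d}\theta$, $b(\theta)=\bar a/a(\theta)-1=\sum_n\hat b_n e^{\mathrm{i}n\cdot\theta}$ (so $\hat b_0=0$). For $I\in\Omega$, $v_I(\theta)=\sum_{n\ne0}\frac{\hat b_n}{\mathrm{i}\,n\cdot\omega(I)}e^{\mathrm{i}n\cdot\theta}$ is the zero-mean solution of $\omega(I)\cdot\nabla_\theta v_I(\theta)=b(\theta)$. The underlying weighted Hamiltonian system is $\dot I=0$, $\dot\theta=a(\theta)\,\omega(I)$. *)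

theory Defs
  imports "HOL-Analysis.Analysis"
begin

text \<open>\<open>C\<^sup>k\<close> functions on an open set; only used for open \<open>S\<close>.\<close>

fun Ck_on :: "nat \<Rightarrow> ('a::real_normed_vector \<Rightarrow> 'b::real_normed_vector) \<Rightarrow> 'a set \<Rightarrow> bool" where
  "Ck_on 0 f S \<longleftrightarrow> continuous_on S f"
| "Ck_on (Suc k) f S \<longleftrightarrow>
     (\<forall>x\<in>S. f differentiable (at x)) \<and>
     (\<forall>v. Ck_on k (\<lambda>x. frechet_derivative f (at x) v) S)"

text \<open>
  Near each boundary point, \<open>S\<close> is the part of a ball lying strictly above the graph of a
  Lipschitz function, where ``up'' is a unit vector \<open>e\<close> and the graph is taken over the
  hyperplane orthogonal to \<open>e\<close>.
\<close>

definition bounded_lipschitz_domain :: "'a::euclidean_space set \<Rightarrow> bool" where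
  "bounded_lipschitz_domain S \<longleftrightarrow>
     S \<noteq> {} \<and> open S \<and> connected S \<and> bounded S \<and>
     (\<forall>x\<in>frontier S. \<exists>e g L d. norm e = 1 \<and> 0 < d \<and>
        L-lipschitz_on {z. z \<bullet> e = 0} (g :: 'a \<Rightarrow> real) \<and>
        S \<inter> ball x d = {y \<in> ball x d. g (y - (y \<bullet> e) *\<^sub>R e) < y \<bullet> e})"

definition int_vec :: "int ^ 'n \<Rightarrow> real ^ 'n" where
  "int_vec n = (\<chi> i. of_int (n $ i))"

lemma int_vec_nth [simp]: "int_vec n $ i = of_int (n $ i)"
  by (simp add: int_vec_def)

lemma int_vec_0 [simp]: "int_vec 0 = 0"
  and int_vec_add: "int_vec (k + l) = int_vec k + int_vec l"
  and int_vec_minus: "int_vec (- k) = - int_vec k"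
  by (simp_all add: vec_eq_iff)


definition torus_rel :: "real ^ 'n \<Rightarrow> real ^ 'n \<Rightarrow> bool" where
  "torus_rel x y \<longleftrightarrow> (\<exists>k. x = y + (2 * pi) *\<^sub>R int_vec k)"

lemma equivp_torus_rel: "equivp torus_rel"
proof (rule equivpI)
  show "reflp torus_rel"
    by (auto simp: reflp_def torus_rel_def intro!: exI[of _ 0])
  show "symp torus_rel"
  proof (rule sympI)
    fix x y :: "real ^ 'n" assume "torus_rel x y"
    then obtain k where "x = y + (2 * pi) *\<^sub>R int_vec k" by (auto simp: torus_rel_def)
    then have "y = x + (2 * pi) *\<^sub>R int_vec (- k)" by (simp add: int_vec_minus)
    then show "torus_rel y x" unfolding torus_rel_def by blast
  qed
  show "transp torus_rel"
  proof (rule transpI)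
    fix x y z :: "real ^ 'n" assume "torus_rel x y" "torus_rel y z"
    then obtain k l where "x = y + (2 * pi) *\<^sub>R int_vec k" "y = z + (2 * pi) *\<^sub>R int_vec l"
      by (auto simp: torus_rel_def)
    then have "x = z + (2 * pi) *\<^sub>R int_vec (k + l)"
      by (simp add: int_vec_add scaleR_add_right)
    then show "torus_rel x z" unfolding torus_rel_def by blast
  qed
qed

quotient_type (overloaded) 'n torus = "real ^ 'n" / torus_rel
  morphisms rep_torus to_torus
  by (rule equivp_torus_rel)

text \<open>The quotient topology, so that \<open>borel\<close> below is the Borel algebra of the torus.\<close>

instantiation torus :: (finite) topological_space
begin

definition open_torus :: "'a torus set \<Rightarrow> bool" where
  "open_torus U \<longleftrightarrow> open (to_torus -` U)"

instance
proof
  fix K :: "'a torus set set"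
  assume "\<forall>U\<in>K. open U"
  then show "open (\<Union>K)"
    unfolding open_torus_def vimage_Union by blast
qed (auto simp: open_torus_def vimage_Int)

end

lemma continuous_on_to_torus: "continuous_on UNIV to_torus"
  by (auto simp: continuous_on_open_vimage open_torus_def)

lift_definition torus_translate :: "'n::finite torus \<Rightarrow> real ^ 'n \<Rightarrow> 'n torus"
  is "\<lambda>x w. x + w"
  by (auto simp: torus_rel_def)

text \<open>The character \<open>\<theta> \<mapsto> e\<^bsup>i n\<cdot>\<theta>\<^esup>\<close>.\<close>

lift_definition torus_char :: "int ^ 'n \<Rightarrow> 'n::finite torus \<Rightarrow> complex"
  is "\<lambda>n x. cis (int_vec n \<bullet> x)"
proof -
  fix n :: "int ^ 'n" and x y :: "real ^ 'n"
  assume "torus_rel x y"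
  then obtain k where "x = y + (2 * pi) *\<^sub>R int_vec k"
    by (auto simp: torus_rel_def)
  moreover have "int_vec n \<bullet> int_vec k = of_int (\<Sum>i\<in>UNIV. n $ i * k $ i)"
    by (simp add: inner_vec_def)
  ultimately have "int_vec n \<bullet> x = int_vec n \<bullet> y + 2 * pi * of_int (\<Sum>i\<in>UNIV. n $ i * k $ i)"
    by (simp add: inner_add_right)
  then show "cis (int_vec n \<bullet> x) = cis (int_vec n \<bullet> y)"
    by (simp only: cis_mult [symmetric] cis_multiple_2pi Ints_of_int mult_1_right)
qed

definition torus_cell :: "(real ^ 'n) set" where
  "torus_cell = {x. \<forall>i. 0 \<le> x $ i \<and> x $ i < 2 * pi}"

text \<open>Lebesgue measure \<open>d\<theta>\<close>, of total mass \<open>(2 * pi) ^ N\<close>.\<close>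

definition torus_lebesgue :: "'n::finite torus measure" where
  "torus_lebesgue = distr (restrict_space lborel torus_cell) borel to_torus"

lemma emeasure_torus_lebesgue:
  fixes A :: "'n::finite torus set"
  assumes "A \<in> sets borel"
  shows "emeasure torus_lebesgue A = emeasure lborel (to_torus -` A \<inter> torus_cell)"
proof -
  have cell: "torus_cell \<in> sets (borel :: (real ^ 'n) measure)"
    unfolding torus_cell_def by measurable
  have meas: "to_torus \<in> borel_measurable (borel :: (real ^ 'n) measure)"
    by (rule borel_measurable_continuous_onI[OF continuous_on_to_torus])
  then have "to_torus \<in> restrict_space lborel torus_cell \<rightarrow>\<^sub>M (borel :: 'n torus measure)"
    by (intro measurable_restrict_space1) simp
  then show ?thesis
    using assms cell
    by (simp add: torus_lebesgue_def emeasure_distr space_restrict_space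
        emeasure_restrict_space)
qed

definition torus_Ck_fun :: "nat \<Rightarrow> ('n::finite torus \<Rightarrow> 'b::real_normed_vector) \<Rightarrow> bool" where
  "torus_Ck_fun k f \<longleftrightarrow> Ck_on k (\<lambda>x. f (to_torus x)) UNIV"

text \<open>
  The charts of the torus are the local inverses of the projection, so a self-map is \<open>C\<^sup>k\<close> iff
  it has a \<open>C\<^sup>k\<close> lift near every point; likewise for the velocity of a curve.
\<close>

definition torus_Ck_map :: "nat \<Rightarrow> ('n::finite torus \<Rightarrow> 'n torus) \<Rightarrow> bool" where
  "torus_Ck_map k F \<longleftrightarrow>
     (\<forall>x. \<exists>U G. open U \<and> x \<in> U \<and> Ck_on k G U \<and>
        (\<forall>y\<in>U. F (to_torus y) = to_torus (G y)))"

definition torus_Ck_diffeo :: "nat \<Rightarrow> ('n::finite torus \<Rightarrow> 'n torus) \<Rightarrow> bool" where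
  "torus_Ck_diffeo k F \<longleftrightarrow> bij F \<and> torus_Ck_map k F \<and> torus_Ck_map k (inv F)"

definition torus_has_velocity ::
    "(real \<Rightarrow> 'n::finite torus) \<Rightarrow> real ^ 'n \<Rightarrow> real \<Rightarrow> real set \<Rightarrow> bool" where
  "torus_has_velocity c w t J \<longleftrightarrow>
     (\<exists>x d. 0 < d \<and> (\<forall>s\<in>J. \<bar>s - t\<bar> < d \<longrightarrow> c s = to_torus (x s)) \<and>
        (x has_vector_derivative w) (at t within J))"


definition weight_a :: "('n::finite torus \<Rightarrow> real) \<Rightarrow> 'n torus \<Rightarrow> real" where
  "weight_a m \<theta> = m \<theta> powr (- 1 / real CARD('n))"

definition weight_rho :: "('n::finite torus \<Rightarrow> real) \<Rightarrow> 'n torus \<Rightarrow> real" where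
  "weight_rho m \<theta> = m \<theta> powr (1 / real CARD('n))"

definition a_bar :: "('n::finite torus \<Rightarrow> real) \<Rightarrow> real" where
  "a_bar m = (2 * pi) ^ CARD('n) / (LINT \<theta>|torus_lebesgue. weight_rho m \<theta>)"

definition weight_b :: "('n::finite torus \<Rightarrow> real) \<Rightarrow> 'n torus \<Rightarrow> real" where
  "weight_b m \<theta> = a_bar m / weight_a m \<theta> - 1"

definition torus_fourier :: "('n::finite torus \<Rightarrow> complex) \<Rightarrow> int ^ 'n \<Rightarrow> complex" where
  "torus_fourier f n =
     (LINT \<theta>|torus_lebesgue. f \<theta> * torus_char (- n) \<theta>) / of_real ((2 * pi) ^ CARD('n))"

definition v_series ::
    "('n::finite torus \<Rightarrow> real) \<Rightarrow> real ^ 'n \<Rightarrow> 'n torus \<Rightarrow> complex" where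
  "v_series m w \<theta> =
     (\<Sum>\<^sub>\<infinity>n\<in>-{0}. torus_fourier (\<lambda>\<theta>. complex_of_real (weight_b m \<theta>)) n
        / (\<i> * complex_of_real (int_vec n \<bullet> w)) * torus_char n \<theta>)"

text \<open>
  \<open>w\<close> stands for \<open>\<omega>(I)\<close>. The series is real, as the terms for \<open>n\<close> and \<open>- n\<close> are conjugate
  (see \<open>of_real_v_sol\<close>), so \<open>Re\<close> only changes the type.
\<close>

definition v_sol :: "('n::finite torus \<Rightarrow> real) \<Rightarrow> real ^ 'n \<Rightarrow> 'n torus \<Rightarrow> real" where
  "v_sol m w \<theta> = Re (v_series m w \<theta>)"

lemma cnj_torus_char: "cnj (torus_char n \<theta>) = torus_char (- n) \<theta>"
  by transfer (simp add: cis_cnj int_vec_minus)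

lemma of_real_v_sol: "complex_of_real (v_sol m w \<theta>) = v_series m w \<theta>"
proof -
  let ?F = "torus_fourier (\<lambda>\<theta>. complex_of_real (weight_b m \<theta>))"
  let ?t = "\<lambda>n. ?F n / (\<i> * complex_of_real (int_vec n \<bullet> w)) * torus_char n \<theta>"
  have "cnj (?F n) = ?F (- n)" for n
    by (simp add: torus_fourier_def Bochner_Integration.integral_cnj [symmetric] cnj_torus_char
        del: Bochner_Integration.integral_cnj)
  then have t: "cnj (?t n) = ?t (- n)" for n
    by (simp add: cnj_torus_char int_vec_minus)
  have "cnj (v_series m w \<theta>) = (\<Sum>\<^sub>\<infinity>n\<in>-{0}. ?t (- n))"
    unfolding v_series_def infsum_cnj [symmetric] t ..
  also have "\<dots> = v_series m w \<theta>"
    unfolding v_series_def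
    by (rule infsum_reindex_bij_witness[of _ uminus uminus]) auto
  finally have "Im (v_series m w \<theta>) = 0"
    by (simp add: complex_eq_iff)
  then show ?thesis
    by (simp add: v_sol_def complex_eq_iff)
qed

definition conjugacy :: "('n::finite torus \<Rightarrow> real) \<Rightarrow> real ^ 'n \<Rightarrow> 'n torus \<Rightarrow> 'n torus" where
  "conjugacy m w \<theta> = torus_translate \<theta> (v_sol m w \<theta> *\<^sub>R w)"

end

theory Submission
  imports Defs
begin

text \<open>
  Write \<open>w\<close> for the frequency vector \<open>\<omega>(I)\<close> and \<open>v\<close> for the solution of \<open>w \<cdot> \<nabla>v = b\<close>. Everything rests on
  the identity \<open>1 + w \<cdot> \<nabla>v = 1 + b = a\<^sub>0 / a = a\<^sub>0 \<rho>\<close>, where \<open>a\<^sub>0\<close> stands for the mean constant \<open>a_bar\<close>.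

  The identity itself and the regularity of \<open>v\<close> come from Fourier analysis. Integration by parts shows
  that the coefficients of the \<open>C\<^sup>q\<close> function \<open>b\<close> decay like \<open>\<bar>n\<bar>\<^bsup>-q\<^esup>\<close>; the Diophantine condition costs
  a factor \<open>\<bar>n\<bar>\<^sup>\<tau>\<close>; and \<open>q - \<tau> - r > N\<close> makes the \<open>r\<close> times differentiated series of \<open>v\<close> converge
  absolutely (\<open>small_divisor_coeff_summable\<close>). Termwise differentiation along \<open>w\<close> then gives the
  Fourier series of \<open>b\<close>, which sums to \<open>b\<close> because a continuous function is determined by its
  coefficients (\<open>cohomological_equation\<close>).

  The conjugacy \<open>\<theta> \<mapsto> \<theta> + v(\<theta>) w\<close> preserves each line parallel to \<open>w\<close>, and on such a line it has the
  derivative \<open>1 + w \<cdot> \<nabla>v > 0\<close>. Since \<open>v\<close> is bounded, the lift to \<open>\<real>\<^sup>N\<close> is bijective; its differential is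
  a rank-one perturbation of the identity with an explicit inverse, so the inverse map inherits the
  regularity of \<open>v\<close> (\<open>shear_diffeo\<close>). A velocity \<open>a w\<close> is mapped to \<open>a (1 + w \<cdot> \<nabla>v) w = a\<^sub>0 w\<close>
  (\<open>shear_velocity\<close>).

  The statement on measures is obtained without a change of variables: along \<open>w\<close>, the derivative of
  a character composed with the conjugacy is a nonzero multiple of that function times \<open>\<rho>\<close>, and the
  integral of a derivative is zero. So all nontrivial Fourier coefficients of the pushforward vanish,
  and a finite Borel measure on the torus is determined by its Fourier coefficients
  (\<open>torus_measure_eqI\<close>, \<open>shear_pushforward\<close>). Both uniqueness theorems follow from the density of
  trigonometric polynomials (\<open>trig_poly_dense\<close>).
\<close>

section \<open>Calculus of \<open>C\<^sup>k\<close> maps\<close>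

lemma Ck_on_SucI:
  assumes "\<And>x. (f has_derivative f' x) (at x)" and "\<And>v. Ck_on k (\<lambda>x. f' x v) UNIV"
  shows "Ck_on (Suc k) f UNIV"
proof -
  have "frechet_derivative f (at x) = f' x" for x
    using frechet_derivative_at[OF assms(1)] by simp
  then show ?thesis
    using assms by (auto simp: differentiable_def)
qed

lemma Ck_on_SucD:
  assumes "Ck_on (Suc k) f UNIV"
  shows "(f has_derivative frechet_derivative f (at x)) (at x)"
    and "Ck_on k (\<lambda>x. frechet_derivative f (at x) v) UNIV"
  using assms by (auto simp: frechet_derivative_works)

lemma Ck_on_Suc_imp:
  "Ck_on (Suc k) f UNIV \<Longrightarrow> Ck_on k f UNIV"
proof (induction k arbitrary: f)
  case 0
  then show ?case
    by (auto simp: continuous_on_eq_continuous_at intro: differentiable_imp_continuous_within)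
next
  case (Suc k)
  show ?case
    by (rule Ck_on_SucI[OF Ck_on_SucD(1)[OF Suc.prems]])
       (rule Suc.IH[OF Ck_on_SucD(2)[OF Suc.prems]])
qed

lemma Ck_on_mono:
  assumes "j \<le> k" and "Ck_on k f UNIV"
  shows "Ck_on j f UNIV"
  using assms by (induction rule: inc_induct) (auto intro: Ck_on_Suc_imp simp del: Ck_on.simps)

lemma Ck_on_const: "Ck_on k (\<lambda>x. c) UNIV"
proof (induction k arbitrary: c)
  case (Suc k)
  show ?case by (rule Ck_on_SucI[of _ "\<lambda>x v. 0"]) (auto intro: Suc)
qed simp

lemma Ck_on_linear_comp:
  assumes "bounded_linear L"
  shows "Ck_on k f UNIV \<Longrightarrow> Ck_on k (\<lambda>x. L (f x)) UNIV"
proof (induction k arbitrary: f)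
  case 0
  then show ?case
    by (auto intro: bounded_linear.continuous_on[OF assms])
next
  case (Suc k)
  show ?case
    by (rule Ck_on_SucI[OF bounded_linear.has_derivative[OF assms Ck_on_SucD(1)[OF Suc.prems]]])
       (rule Suc.IH[OF Ck_on_SucD(2)[OF Suc.prems]])
qed

lemma Ck_on_add:
  "Ck_on k f UNIV \<Longrightarrow> Ck_on k g UNIV \<Longrightarrow> Ck_on k (\<lambda>x. f x + g x) UNIV"
proof (induction k arbitrary: f g)
  case 0
  then show ?case by (simp add: continuous_on_add)
next
  case (Suc k)
  show ?case
    by (rule Ck_on_SucI[OF has_derivative_add[OF Ck_on_SucD(1)[OF Suc.prems(1)]
          Ck_on_SucD(1)[OF Suc.prems(2)]]])
       (rule Suc.IH[OF Ck_on_SucD(2)[OF Suc.prems(1)] Ck_on_SucD(2)[OF Suc.prems(2)]])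
qed

lemma Ck_on_sum:
  assumes "\<And>i. i \<in> A \<Longrightarrow> Ck_on k (f i) UNIV"
  shows "Ck_on k (\<lambda>x. \<Sum>i\<in>A. f i x) UNIV"
  using assms by (induction A rule: infinite_finite_induct) (auto intro: Ck_on_const Ck_on_add)

lemma Ck_on_bilinear:
  assumes "bounded_bilinear B"
  shows "Ck_on k f UNIV \<Longrightarrow> Ck_on k g UNIV \<Longrightarrow> Ck_on k (\<lambda>x. B (f x) (g x)) UNIV"
proof (induction k arbitrary: f g)
  case 0
  then show ?case by (auto intro: bounded_bilinear.continuous_on[OF assms])
next
  case (Suc k)
  show ?case
    by (rule Ck_on_SucI[OF bounded_bilinear.FDERIV[OF assms Ck_on_SucD(1)[OF Suc.prems(1)]
          Ck_on_SucD(1)[OF Suc.prems(2)]]])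
       (rule Ck_on_add[OF
          Suc.IH[OF Ck_on_Suc_imp[OF Suc.prems(1)] Ck_on_SucD(2)[OF Suc.prems(2)]]
          Suc.IH[OF Ck_on_SucD(2)[OF Suc.prems(1)] Ck_on_Suc_imp[OF Suc.prems(2)]]])
qed

lemmas Ck_on_mult = Ck_on_bilinear[OF bounded_bilinear_mult]
  and Ck_on_scaleR = Ck_on_bilinear[OF bounded_bilinear_scaleR]

lemma Ck_on_diff:
  "Ck_on k f UNIV \<Longrightarrow> Ck_on k g UNIV \<Longrightarrow> Ck_on k (\<lambda>x. f x - g x) UNIV"
  using Ck_on_add[OF _ Ck_on_linear_comp[OF bounded_linear_minus[OF bounded_linear_ident]], of k f g]
  by simp

lemma Ck_on_linear:
  assumes "bounded_linear L"
  shows "Ck_on k L UNIV"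
proof (cases k)
  case 0
  then show ?thesis
    using bounded_linear.continuous_on[OF assms continuous_on_id] by simp
next
  case (Suc j)
  show ?thesis unfolding Suc
    by (rule Ck_on_SucI[OF bounded_linear_imp_has_derivative[OF assms]]) (rule Ck_on_const)
qed

text \<open>
  In the derivative \<open>Dg(f x)(Df x v)\<close> the point \<open>x\<close> enters both through the base point and
  through the direction. Expanding the direction in a basis of the middle space turns this into a
  finite sum of products of functions of \<open>x\<close>, to which the induction hypothesis and the product
  rule apply.
\<close>

lemma Ck_on_compose:
  fixes f :: "'a::real_normed_vector \<Rightarrow> 'b::euclidean_space" and g :: "'b \<Rightarrow> 'c::real_normed_vector"
  shows "Ck_on k g UNIV \<Longrightarrow> Ck_on k f UNIV \<Longrightarrow> Ck_on k (\<lambda>x. g (f x)) UNIV"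
proof (induction k arbitrary: f g)
  case 0
  then show ?case using continuous_on_compose2[of UNIV g UNIV f] by simp
next
  case (Suc k)
  let ?f' = "\<lambda>x. frechet_derivative f (at x)" and ?g' = "\<lambda>y. frechet_derivative g (at y)"
  have g': "((g has_derivative ?g' y) (at y))" for y
    by (rule Ck_on_SucD(1)[OF Suc.prems(1)])
  have eq: "?g' (f x) (?f' x v) = (\<Sum>b\<in>Basis. (?f' x v \<bullet> b) *\<^sub>R ?g' (f x) b)" for x v
  proof -
    interpret g': bounded_linear "?g' (f x)"
      using g' by (rule has_derivative_bounded_linear)
    show ?thesis
      by (subst euclidean_representation[of "?f' x v", symmetric])
         (simp only: g'.sum g'.scaleR)
  qed
  show ?case
  proof (rule Ck_on_SucI)
    show "((\<lambda>x. g (f x)) has_derivative (\<lambda>v. ?g' (f x) (?f' x v))) (at x)" for x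
      by (rule has_derivative_compose[OF Ck_on_SucD(1)[OF Suc.prems(2)] g'])
    show "Ck_on k (\<lambda>x. ?g' (f x) (?f' x v)) UNIV" for v
      unfolding eq
      by (intro Ck_on_sum Ck_on_scaleR Ck_on_linear_comp[OF bounded_linear_inner_left]
          Suc.IH Ck_on_SucD(2) Ck_on_Suc_imp[OF Suc.prems(2)] Suc.prems)
  qed
qed

text \<open>
  The exponent varies in the induction, since each differentiation lowers it by one.
\<close>

lemma Ck_on_powr:
  fixes f :: "'a::real_normed_vector \<Rightarrow> real"
  assumes "\<And>x. 0 < f x"
  shows "Ck_on k f UNIV \<Longrightarrow> Ck_on k (\<lambda>x. f x powr p) UNIV"
proof (induction k arbitrary: p)
  case 0
  then show ?case
    by (auto intro!: continuous_on_powr continuous_on_const) (metis assms less_irrefl)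
next
  case (Suc k)
  show ?case
  proof (rule Ck_on_SucI)
    show "((\<lambda>x. f x powr p) has_derivative
        (\<lambda>v. (p * f x powr (p - 1)) * frechet_derivative f (at x) v)) (at x)" for x
      by (rule has_derivative_eq_rhs, rule has_derivative_powr[OF Ck_on_SucD(1)[OF Suc.prems]
           has_derivative_const assms])
         (use assms[of x] in \<open>auto simp: powr_diff field_simps\<close>)
    show "Ck_on k (\<lambda>x. (p * f x powr (p - 1)) * frechet_derivative f (at x) v) UNIV" for v
      by (rule Ck_on_mult[OF Ck_on_mult[OF Ck_on_const Suc.IH[OF Ck_on_Suc_imp[OF Suc.prems]]]
            Ck_on_SucD(2)[OF Suc.prems]])
  qed
qed


section \<open>Topology and Lebesgue measure of the torus\<close>

lemma to_torus_eq_iff: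
  "to_torus x = to_torus y \<longleftrightarrow> (\<exists>k. x = y + (2 * pi) *\<^sub>R int_vec k)"
  by (simp add: torus.abs_eq_iff torus_rel_def)

lemma to_torus_rep [simp]: "to_torus (rep_torus \<theta>) = \<theta>"
  by (rule Quotient_abs_rep[OF Quotient_torus])

lemma to_torus_periodic [simp]: "to_torus (x + (2 * pi) *\<^sub>R int_vec k) = to_torus x"
  by (auto simp: to_torus_eq_iff)

text \<open>
  Together with the next lemma: every point has exactly one lattice translate in the fundamental
  cell, so the translates of the cell tile the space.
\<close>

lemma torus_cell_tiling:
  obtains k where "x + (2 * pi) *\<^sub>R int_vec k \<in> torus_cell"
proof
  show "x + (2 * pi) *\<^sub>R int_vec (\<chi> i. - \<lfloor>x $ i / (2 * pi)\<rfloor>) \<in> torus_cell"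
    unfolding torus_cell_def
  proof (intro CollectI allI)
    fix i
    have "of_int \<lfloor>x $ i / (2 * pi)\<rfloor> \<le> x $ i / (2 * pi)" 
      "x $ i / (2 * pi) < of_int \<lfloor>x $ i / (2 * pi)\<rfloor> + 1"
      by linarith+
    then have "of_int \<lfloor>x $ i / (2 * pi)\<rfloor> * (2 * pi) \<le> x $ i"
      "x $ i < (of_int \<lfloor>x $ i / (2 * pi)\<rfloor> + 1) * (2 * pi)"
      by (simp_all only: pos_le_divide_eq pos_divide_less_eq pi_gt_zero zero_less_mult_iff
          zero_less_numeral simp_thms)
    then show "0 \<le> (x + (2 * pi) *\<^sub>R int_vec (\<chi> i. - \<lfloor>x $ i / (2 * pi)\<rfloor>)) $ i
        \<and> (x + (2 * pi) *\<^sub>R int_vec (\<chi> i. - \<lfloor>x $ i / (2 * pi)\<rfloor>)) $ i < 2 * pi"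
      by (simp add: algebra_simps)
  qed
qed

lemma torus_cell_tiles_disjoint:
  assumes "x + (2 * pi) *\<^sub>R int_vec k \<in> torus_cell" "x + (2 * pi) *\<^sub>R int_vec l \<in> torus_cell"
  shows "k = l"
proof (rule vec_eq_iff[THEN iffD2], rule allI)
  fix i
  have k: "0 \<le> x $ i + 2 * pi * of_int (k $ i)" "x $ i + 2 * pi * of_int (k $ i) < 2 * pi"
    and l: "0 \<le> x $ i + 2 * pi * of_int (l $ i)" "x $ i + 2 * pi * of_int (l $ i) < 2 * pi"
    using assms by (auto simp: torus_cell_def)
  have "2 * pi * of_int (k $ i) < 2 * pi * (of_int (l $ i) + 1)"
    "2 * pi * of_int (l $ i) < 2 * pi * (of_int (k $ i) + 1)"
    using k l by (simp_all add: distrib_left)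
  then have "(of_int (k $ i) :: real) < of_int (l $ i) + 1" "(of_int (l $ i) :: real) < of_int (k $ i) + 1"
    by (simp_all only: mult_less_cancel_left_pos pi_gt_zero zero_less_mult_iff zero_less_numeral simp_thms)
  then show "k $ i = l $ i" by linarith
qed

lemma torus_cell_subset: "torus_cell \<subseteq> cbox 0 (\<chi> i. 2 * pi)"
  by (auto simp: torus_cell_def mem_box_cart less_imp_le)

lemma continuous_on_torus_iff:
  fixes f :: "'n::finite torus \<Rightarrow> 'b::topological_space"
  shows "continuous_on UNIV f \<longleftrightarrow> continuous_on UNIV (\<lambda>x. f (to_torus x))"
  by (simp add: continuous_on_open_vimage open_torus_def vimage_def)

lemma range_to_torus: "to_torus ` torus_cell = UNIV"
proof (intro set_eqI iffI UNIV_I)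
  fix \<theta> :: "'a torus"
  obtain k where "rep_torus \<theta> + (2 * pi) *\<^sub>R int_vec k \<in> torus_cell"
    by (rule torus_cell_tiling)
  then show "\<theta> \<in> to_torus ` torus_cell"
    by (intro image_eqI[OF _ _]) auto
qed

lemma compact_torus: "compact (UNIV :: 'n::finite torus set)"
proof -
  have "to_torus ` cbox 0 (\<chi> i. 2 * pi) = (UNIV :: 'n torus set)"
    using range_to_torus torus_cell_subset by blast
  then show ?thesis
    using compact_continuous_image[OF continuous_on_subset[OF continuous_on_to_torus subset_UNIV]
        compact_cbox] by metis
qed

lemma torus_char_to_torus: "torus_char n (to_torus x) = cis (int_vec n \<bullet> x)"
  by (rule torus_char.abs_eq)

lemma continuous_on_torus_char: "continuous_on UNIV (torus_char n)"
  unfolding continuous_on_torus_iff torus_char_to_torus by (intro continuous_intros)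

text \<open>
  The coordinate characters already embed the torus in a product of circles. This yields the
  Hausdorff property, the point separation required by the Stone-Weierstrass theorem and, later,
  a distance function to closed sets.
\<close>

lemma torus_char_separates:
  assumes "\<And>i. torus_char (axis i 1) \<theta> = torus_char (axis i 1) \<phi>"
  shows "\<theta> = \<phi>"
proof -
  define x y where "x = rep_torus \<theta>" and "y = rep_torus \<phi>"
  have \<theta>: "\<theta> = to_torus x" and \<phi>: "\<phi> = to_torus y"
    by (simp_all add: x_def y_def)
  have "int_vec (axis i 1) = (axis i 1 :: real ^ 'a)" for i
    by (simp add: vec_eq_iff axis_def)
  then have "cis (x $ i) = cis (y $ i)" for i
    using assms[of i] by (simp add: \<theta> \<phi> torus_char_to_torus inner_axis')
  then have "\<exists>n::int. x $ i = y $ i + 2 * pi * of_int n" for i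
    using sin_cos_eq_iff[of "x $ i" "y $ i"] by (auto simp: complex_eq_iff)
  then obtain n where n: "\<And>i. x $ i = y $ i + 2 * pi * of_int (n i)"
    by metis
  have "x = y + (2 * pi) *\<^sub>R int_vec (\<chi> i. n i)"
    by (simp add: vec_eq_iff n)
  then show ?thesis
    unfolding \<theta> \<phi> to_torus_eq_iff by blast
qed

instance torus :: (finite) t2_space
proof
  fix \<theta> \<phi> :: "'a torus" assume "\<theta> \<noteq> \<phi>"
  then obtain i where "torus_char (axis i 1) \<theta> \<noteq> torus_char (axis i 1) \<phi>"
    using torus_char_separates by blast
  then obtain U V where "open U" "open V" "torus_char (axis i 1) \<theta> \<in> U"
    "torus_char (axis i 1) \<phi> \<in> V" "U \<inter> V = {}"
    by (rule hausdorff[THEN exE]) blast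
  then show "\<exists>U V. open U \<and> open V \<and> \<theta> \<in> U \<and> \<phi> \<in> V \<and> U \<inter> V = {}"
    using continuous_on_torus_char[of "axis i 1"]
    by (intro exI[of _ "torus_char (axis i 1) -` U"] exI[of _ "torus_char (axis i 1) -` V"])
       (auto simp: continuous_on_open_vimage)
qed

lemma torus_translate_to_torus: "torus_translate (to_torus x) w = to_torus (x + w)"
  by (rule torus_translate.abs_eq)

lemma continuous_on_torus_translate: "continuous_on UNIV (\<lambda>\<theta>. torus_translate \<theta> w)"
  unfolding continuous_on_torus_iff torus_translate_to_torus
  by (rule continuous_on_compose2[OF continuous_on_to_torus]) (auto intro: continuous_intros)

lemma sets_torus_lebesgue [simp, measurable_cong]: "sets torus_lebesgue = sets borel"
  and space_torus_lebesgue [simp]: "space torus_lebesgue = UNIV"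
  by (simp_all add: torus_lebesgue_def)

lemma torus_cell_borel [measurable]: "torus_cell \<in> sets borel"
  unfolding torus_cell_def by measurable

lemma emeasure_torus_cell:
  "emeasure lborel (torus_cell :: (real ^ 'n) set) = ennreal ((2 * pi) ^ CARD('n))"
proof -
  have box: "box 0 (\<chi> i. 2 * pi) \<subseteq> (torus_cell :: (real ^ 'n) set)"
    by (auto simp: torus_cell_def mem_box_cart less_imp_le)
  have sub: "(torus_cell :: (real ^ 'n) set) \<subseteq> cbox 0 (\<chi> i. 2 * pi)"
    by (rule torus_cell_subset)
  have card: "prod f Basis = (\<Prod>i\<in>UNIV. f (axis i 1))" for f :: "real ^ 'n \<Rightarrow> real"
  proof -
    have Basis: "(Basis :: (real ^ 'n) set) = range (\<lambda>i. axis i 1)"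
      by (auto simp: Basis_vec_def)
    have inj: "inj (\<lambda>i. axis i 1 :: real ^ 'n)"
      by (simp add: inj_def axis_eq_axis)
    show ?thesis
      unfolding Basis prod.reindex[OF inj] by simp
  qed
  have "(\<Prod>b\<in>Basis. ((\<chi> i. 2 * pi) - (0 :: real ^ 'n)) \<bullet> b) = (2 * pi) ^ CARD('n)"
    unfolding card by (simp add: inner_axis)
  moreover have "\<forall>b\<in>Basis. (0 :: real ^ 'n) \<bullet> b \<le> (\<chi> i. 2 * pi) \<bullet> b"
    by (auto simp: Basis_vec_def inner_axis)
  ultimately have "emeasure lborel (box 0 (\<chi> i. 2 * pi) :: (real ^ 'n) set) = ennreal ((2 * pi) ^ CARD('n))"
    "emeasure lborel (cbox 0 (\<chi> i. 2 * pi) :: (real ^ 'n) set) = ennreal ((2 * pi) ^ CARD('n))"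
    by (simp_all add: emeasure_lborel_box emeasure_lborel_cbox)
  then show ?thesis
    using emeasure_mono[OF box, of lborel] emeasure_mono[OF sub, of lborel]
    by (auto intro: antisym)
qed

lemma emeasure_torus_UNIV:
  "emeasure (torus_lebesgue :: 'n::finite torus measure) UNIV = ennreal ((2 * pi) ^ CARD('n))"
  using emeasure_torus_lebesgue[of "UNIV :: 'n torus set"] emeasure_torus_cell[where 'n = 'n] by simp

interpretation torus_lebesgue: finite_measure "torus_lebesgue :: 'n::finite torus measure"
  by standard (simp add: emeasure_torus_UNIV)

lemma measure_torus_UNIV:
  "measure (torus_lebesgue :: 'n::finite torus measure) UNIV = (2 * pi) ^ CARD('n)"
  by (simp add: measure_def emeasure_torus_UNIV)

lemma emeasure_lborel_translate:
  fixes S :: "'a::euclidean_space set"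
  assumes [measurable]: "S \<in> sets borel"
  shows "emeasure lborel {y. y + c \<in> S} = emeasure lborel S"
proof -
  have "emeasure lborel S = emeasure (distr lborel borel ((+) c)) S"
    by (simp add: lborel_distr_plus)
  also have "\<dots> = emeasure lborel {y. y + c \<in> S}"
    by (subst emeasure_distr) (auto simp: vimage_def add.commute)
  finally show ?thesis ..
qed

text \<open>
  The tiling by translates of the fundamental cell may be centred at any point \<open>u\<close>.
\<close>

lemma emeasure_eq_sum_tiles:
  fixes S :: "(real ^ 'n) set"
  assumes [measurable]: "S \<in> sets borel"
  shows "emeasure lborel S =
    (\<integral>\<^sup>+k. emeasure lborel (S \<inter> {y. y - u + (2 * pi) *\<^sub>R int_vec k \<in> torus_cell}) \<partial>count_space UNIV)"
proof -
  have "S = (\<Union>k. S \<inter> {y. y - u + (2 * pi) *\<^sub>R int_vec k \<in> torus_cell})"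
    by (auto intro: torus_cell_tiling)
  moreover have "disjoint_family (\<lambda>k. S \<inter> {y. y - u + (2 * pi) *\<^sub>R int_vec k \<in> torus_cell})"
    by (auto simp: disjoint_family_on_def dest: torus_cell_tiles_disjoint)
  ultimately show ?thesis
    using emeasure_UN_countable[of UNIV "\<lambda>k. S \<inter> {y. y - u + (2 * pi) *\<^sub>R int_vec k \<in> torus_cell}" lborel]
    by simp
qed

text \<open>
  For a periodic set \<open>B\<close> it has to be shown that \<open>B \<inter> C\<close> and \<open>B \<inter> (C + w)\<close> have the same measure,
  where \<open>C\<close> is the fundamental cell. Cut \<open>C + w\<close> along the tiling by translates of \<open>C\<close> and move every
  piece back into \<open>C\<close> by a lattice vector: the pieces become the parts of \<open>C\<close> cut out by the
  tiling by translates of \<open>C + w\<close>.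
\<close>

lemma distr_torus_translate:
  "distr torus_lebesgue borel (\<lambda>\<theta>. torus_translate \<theta> w) = (torus_lebesgue :: 'n::finite torus measure)"
proof (rule measure_eqI)
  fix A :: "'n torus set" assume "A \<in> sets (distr torus_lebesgue borel (\<lambda>\<theta>. torus_translate \<theta> w))"
  then have A [measurable]: "A \<in> sets borel" by simp
  have [measurable]: "(to_torus :: _ \<Rightarrow> 'n torus) \<in> borel_measurable borel"
    by (rule borel_measurable_continuous_onI[OF continuous_on_to_torus])
  have tr [measurable]: "(\<lambda>\<theta>::'n torus. torus_translate \<theta> w) \<in> borel_measurable borel"
    by (rule borel_measurable_continuous_onI[OF continuous_on_torus_translate])
  define B where "B = {x. to_torus x \<in> A}"
  have B [measurable]: "B \<in> sets borel" unfolding B_def by measurable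
  have per: "x + (2 * pi) *\<^sub>R int_vec k \<in> B \<longleftrightarrow> x \<in> B" for x k
    by (simp add: B_def)
  let ?\<mu> = "emeasure (lborel :: (real ^ 'n) measure)" and ?C = "torus_cell :: (real ^ 'n) set"
  have "emeasure (distr torus_lebesgue borel (\<lambda>\<theta>. torus_translate \<theta> w)) A
      = emeasure torus_lebesgue {\<theta>. torus_translate \<theta> w \<in> A}"
    by (subst emeasure_distr) (auto simp: vimage_def)
  also have "\<dots> = ?\<mu> ({x. x + w \<in> B} \<inter> ?C)"
    by (subst emeasure_torus_lebesgue) (auto simp: vimage_def B_def torus_translate_to_torus)
  also have "{x. x + w \<in> B} \<inter> ?C = {x. x + w \<in> B \<inter> {y. y - w \<in> ?C}}"
    by auto
  also have "?\<mu> \<dots> = ?\<mu> (B \<inter> {y. y - w \<in> ?C})"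
    by (rule emeasure_lborel_translate) measurable
  also have "\<dots> = (\<integral>\<^sup>+k. ?\<mu> (B \<inter> {y. y - w \<in> ?C} \<inter> {y. y - 0 + (2 * pi) *\<^sub>R int_vec k \<in> ?C}) \<partial>count_space UNIV)"
    by (rule emeasure_eq_sum_tiles) measurable
  also have "\<dots> = (\<integral>\<^sup>+k. ?\<mu> (B \<inter> ?C \<inter> {z. z - w + (2 * pi) *\<^sub>R int_vec (- k) \<in> ?C}) \<partial>count_space UNIV)"
  proof (rule nn_integral_cong)
    fix k :: "int ^ 'n"
    have "B \<inter> {y. y - w \<in> ?C} \<inter> {y. y - 0 + (2 * pi) *\<^sub>R int_vec k \<in> ?C}
      = {y. y + (2 * pi) *\<^sub>R int_vec k \<in> B \<inter> ?C \<inter> {z. z - w + (2 * pi) *\<^sub>R int_vec (- k) \<in> ?C}}"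
      by (auto simp: per int_vec_minus)
    also have "?\<mu> \<dots> = ?\<mu> (B \<inter> ?C \<inter> {z. z - w + (2 * pi) *\<^sub>R int_vec (- k) \<in> ?C})"
      by (rule emeasure_lborel_translate) measurable
    finally show "?\<mu> (B \<inter> {y. y - w \<in> ?C} \<inter> {y. y - 0 + (2 * pi) *\<^sub>R int_vec k \<in> ?C}) = \<dots>" .
  qed
  also have "\<dots> = (\<integral>\<^sup>+k. ?\<mu> (B \<inter> ?C \<inter> {z. z - w + (2 * pi) *\<^sub>R int_vec k \<in> ?C}) \<partial>count_space UNIV)"
    by (rule nn_integral_bij_count_space[where g = uminus]) (rule bij_uminus)
  also have "\<dots> = ?\<mu> (B \<inter> ?C)"
    by (rule emeasure_eq_sum_tiles[symmetric]) measurable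
  also have "\<dots> = emeasure torus_lebesgue A"
    by (simp add: emeasure_torus_lebesgue B_def vimage_def)
  finally show "emeasure (distr torus_lebesgue borel (\<lambda>\<theta>. torus_translate \<theta> w)) A = emeasure torus_lebesgue A" .
qed simp

lemma integral_torus_translate:
  fixes f :: "'n::finite torus \<Rightarrow> 'b::{banach, second_countable_topology}"
  assumes "f \<in> borel_measurable borel"
  shows "(LINT \<theta>|torus_lebesgue. f (torus_translate \<theta> w)) = (LINT \<theta>|torus_lebesgue. f \<theta>)"
proof -
  have "(\<lambda>\<theta>::'n torus. torus_translate \<theta> w) \<in> borel_measurable borel"
    by (rule borel_measurable_continuous_onI[OF continuous_on_torus_translate])
  then show ?thesis
    using assms by (subst (2) distr_torus_translate[of w, symmetric], subst integral_distr) auto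
qed

lemma bounded_torus_fun:
  fixes f :: "'n::finite torus \<Rightarrow> 'b::real_normed_vector"
  assumes "continuous_on UNIV f"
  obtains B where "0 < B" "\<And>\<theta>. norm (f \<theta>) \<le> B"
proof -
  have "bounded (range f)"
    by (rule compact_imp_bounded[OF compact_continuous_image[OF assms compact_torus]])
  then show ?thesis
    using that by (auto simp: bounded_pos)
qed

lemma integrable_torus_continuous:
  fixes f :: "'n::finite torus \<Rightarrow> 'b::{banach, second_countable_topology}"
  assumes "continuous_on UNIV f"
  shows "integrable torus_lebesgue f"
proof -
  obtain B where "\<And>\<theta>. norm (f \<theta>) \<le> B"
    using bounded_torus_fun[OF assms] by metis
  moreover have "f \<in> borel_measurable torus_lebesgue"
    using borel_measurable_continuous_onI[OF assms] by simp
  ultimately show ?thesis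
    by (intro torus_lebesgue.integrable_const_bound[of _ B]) auto
qed


section \<open>Directional derivatives and decay of Fourier coefficients\<close>

text \<open>
  The representative of the point is immaterial, because the lift of a function on the torus is
  periodic; see \<open>torus_deriv_eqI\<close>.
\<close>

definition torus_deriv ::
    "('n::finite torus \<Rightarrow> 'b::real_normed_vector) \<Rightarrow> real ^ 'n \<Rightarrow> 'n torus \<Rightarrow> 'b" where
  "torus_deriv f h \<theta> = frechet_derivative (\<lambda>x. f (to_torus x)) (at (rep_torus \<theta>)) h"

lemma torus_deriv_eqI:
  assumes "((\<lambda>x. f (to_torus x)) has_derivative D) (at x)"
  shows "torus_deriv f h (to_torus x) = D h"
proof -
  let ?y = "rep_torus (to_torus x)"
  obtain k where k: "?y = x + (2 * pi) *\<^sub>R int_vec k"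
    using to_torus_rep[of "to_torus x"] unfolding to_torus_eq_iff by metis
  have "((\<lambda>y. y + (2 * pi) *\<^sub>R int_vec (- k)) has_derivative (\<lambda>h. h)) (at ?y)"
    by (auto intro!: derivative_eq_intros)
  moreover have "((\<lambda>x. f (to_torus x)) has_derivative D) (at (?y + (2 * pi) *\<^sub>R int_vec (- k)))"
    using assms by (simp add: k int_vec_minus)
  ultimately have "((\<lambda>y. f (to_torus (y + (2 * pi) *\<^sub>R int_vec (- k)))) has_derivative D) (at ?y)"
    by (rule has_derivative_compose[where g = "\<lambda>x. f (to_torus x)"])
  then have "((\<lambda>y. f (to_torus y)) has_derivative D) (at ?y)"
    by (simp only: to_torus_periodic)
  from frechet_derivative_at[OF this] show ?thesis
    by (simp add: torus_deriv_def)
qed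

lemma torus_Ck_fun_has_derivative:
  assumes "torus_Ck_fun (Suc k) f"
  shows "((\<lambda>x. f (to_torus x)) has_derivative (\<lambda>h. torus_deriv f h (to_torus x))) (at x)"
proof -
  have *: "((\<lambda>x. f (to_torus x)) has_derivative frechet_derivative (\<lambda>x. f (to_torus x)) (at x)) (at x)"
    using assms unfolding torus_Ck_fun_def by (rule Ck_on_SucD)
  show ?thesis
    unfolding torus_deriv_eqI[OF *] by (rule *)
qed

lemma torus_Ck_fun_deriv:
  assumes "torus_Ck_fun (Suc k) f"
  shows "torus_Ck_fun k (torus_deriv f h)"
proof -
  have "torus_deriv f h (to_torus x) = frechet_derivative (\<lambda>x. f (to_torus x)) (at x) h" for x
    by (rule torus_deriv_eqI[OF Ck_on_SucD(1)[OF assms[unfolded torus_Ck_fun_def]]])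
  then show ?thesis
    using Ck_on_SucD(2)[OF assms[unfolded torus_Ck_fun_def]] by (simp add: torus_Ck_fun_def)
qed

lemma torus_Ck_fun_SucI:
  assumes "\<And>x. ((\<lambda>x. f (to_torus x)) has_derivative (\<lambda>h. f' h (to_torus x))) (at x)"
    and "\<And>h. torus_Ck_fun k (f' h)"
  shows "torus_Ck_fun (Suc k) f"
  unfolding torus_Ck_fun_def
  by (rule Ck_on_SucI[of _ "\<lambda>x h. f' h (to_torus x)"])
     (rule assms(1), rule assms(2)[unfolded torus_Ck_fun_def])

lemma torus_Ck_fun_mono: "torus_Ck_fun k f \<Longrightarrow> j \<le> k \<Longrightarrow> torus_Ck_fun j f"
  unfolding torus_Ck_fun_def by (rule Ck_on_mono)

lemma torus_Ck_fun_0: "torus_Ck_fun 0 f \<longleftrightarrow> continuous_on UNIV f"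
  by (simp add: torus_Ck_fun_def continuous_on_torus_iff)

lemma torus_Ck_fun_continuous: "torus_Ck_fun k f \<Longrightarrow> continuous_on UNIV f"
  using torus_Ck_fun_mono[of k f 0] by (simp add: torus_Ck_fun_0)

lemma has_derivative_cis_inner:
  fixes u :: "'a::real_inner"
  shows "((\<lambda>x. cis (u \<bullet> x)) has_derivative (\<lambda>h. \<i> * of_real (u \<bullet> h) * cis (u \<bullet> x))) (at x)"
proof -
  have "((\<lambda>x. \<i> * complex_of_real (u \<bullet> x)) has_derivative (\<lambda>h. \<i> * complex_of_real (u \<bullet> h))) (at x)"
    by (auto intro!: derivative_eq_intros)
  from has_derivative_compose[OF this DERIV_exp[unfolded has_field_derivative_def]]
  show ?thesis
    by (simp add: cis_conv_exp mult_ac)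
qed

lemma torus_Ck_fun_char: "torus_Ck_fun k (torus_char n)"
proof -
  have "Ck_on k (\<lambda>x. cis (int_vec n \<bullet> x)) UNIV"
  proof (induction k)
    case 0
    have "continuous_on UNIV (\<lambda>x. cis (int_vec n \<bullet> x))"
      by (intro continuous_intros)
    then show ?case by simp
  next
    case (Suc k)
    show ?case
    proof (rule Ck_on_SucI)
      show "((\<lambda>x. cis (int_vec n \<bullet> x)) has_derivative
          (\<lambda>h. (\<i> * of_real (int_vec n \<bullet> h)) * cis (int_vec n \<bullet> x))) (at x)" for x
        by (rule has_derivative_cis_inner)
      show "Ck_on k (\<lambda>x. (\<i> * of_real (int_vec n \<bullet> h)) * cis (int_vec n \<bullet> x)) UNIV" for h
        by (intro Ck_on_mult Ck_on_const Suc)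
    qed
  qed
  then show ?thesis
    by (simp add: torus_Ck_fun_def torus_char_to_torus)
qed

lemma torus_deriv_char:
  "torus_deriv (torus_char n) h \<theta> = \<i> * of_real (int_vec n \<bullet> h) * torus_char n \<theta>"
proof -
  have "((\<lambda>x. torus_char n (to_torus x)) has_derivative
      (\<lambda>h. (\<i> * of_real (int_vec n \<bullet> h)) * cis (int_vec n \<bullet> x))) (at x)" for x
    unfolding torus_char_to_torus by (rule has_derivative_cis_inner)
  from torus_deriv_eqI[OF this, of h "rep_torus \<theta>"] show ?thesis
    by (simp flip: torus_char_to_torus)
qed

text \<open>
  The integral of every difference quotient vanishes by translation invariance. The difference
  quotients converge pointwise to the derivative and, by the mean value inequality, are bounded by
  its maximum, so dominated convergence applies.
\<close>

lemma integral_torus_deriv: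
  fixes f :: "'n::finite torus \<Rightarrow> complex"
  assumes f: "torus_Ck_fun (Suc 0) f"
  shows "(LINT \<theta>|torus_lebesgue. torus_deriv f h \<theta>) = 0"
proof -
  have cont: "continuous_on UNIV f" "continuous_on UNIV (torus_deriv f h)"
    using f torus_Ck_fun_deriv[OF f] by (auto intro: torus_Ck_fun_continuous)
  obtain B where B: "0 < B" "\<And>\<theta>. norm (torus_deriv f h \<theta>) \<le> B"
    using bounded_torus_fun[OF cont(2)] by metis
  define t :: "nat \<Rightarrow> real" where "t k = 1 / (real k + 1)" for k
  have t: "0 < t k" for k by (simp add: t_def)
  define X where "X k \<theta> = (f (torus_translate \<theta> (t k *\<^sub>R h)) - f \<theta>) /\<^sub>R t k" for k \<theta>
  have line: "((\<lambda>s. f (to_torus (x + s *\<^sub>R h))) has_derivative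
      (\<lambda>s. s *\<^sub>R torus_deriv f h (to_torus (x + s0 *\<^sub>R h)))) (at s0)" for x s0
  proof -
    have "((\<lambda>s. f (to_torus (x + s *\<^sub>R h))) has_derivative
        (\<lambda>s. torus_deriv f (s *\<^sub>R h) (to_torus (x + s0 *\<^sub>R h)))) (at s0)"
      by (rule has_derivative_compose[OF _ torus_Ck_fun_has_derivative[OF f]])
         (auto intro!: derivative_eq_intros)
    moreover have "torus_deriv f (s *\<^sub>R h) \<phi> = s *\<^sub>R torus_deriv f h \<phi>" for s \<phi>
      using linear_scale[OF has_derivative_linear[OF torus_Ck_fun_has_derivative[OF f, of "rep_torus \<phi>"]]]
      by simp
    ultimately show ?thesis by simp
  qed
  have bound: "norm (X k \<theta>) \<le> B" for k \<theta>
  proof -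
    let ?g = "\<lambda>s. f (to_torus (rep_torus \<theta> + s *\<^sub>R h))"
    have "norm (?g (t k) - ?g 0) \<le> B * norm (t k - 0)"
    proof (rule differentiable_bound[OF convex_UNIV])
      show "(?g has_derivative (\<lambda>s. s *\<^sub>R torus_deriv f h (to_torus (rep_torus \<theta> + s0 *\<^sub>R h))))
          (at s0 within UNIV)" for s0
        by (rule line)
      show "onorm (\<lambda>s. s *\<^sub>R torus_deriv f h (to_torus (rep_torus \<theta> + s0 *\<^sub>R h))) \<le> B" for s0
        by (rule onorm_bound) (use B in \<open>auto simp: mult.commute[of B] intro: mult_left_mono\<close>)
    qed auto
    moreover have "norm (X k \<theta>) = norm (?g (t k) - ?g 0) / t k"
      using t[of k] torus_translate_to_torus[of "rep_torus \<theta>" "t k *\<^sub>R h"]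
      by (simp add: X_def divide_inverse mult.commute)
    ultimately show ?thesis
      using t[of k] by (simp add: pos_divide_le_eq)
  qed
  have lim: "(\<lambda>k. X k \<theta>) \<longlonglongrightarrow> torus_deriv f h \<theta>" for \<theta>
  proof -
    let ?g = "\<lambda>s. f (to_torus (rep_torus \<theta> + s *\<^sub>R h))"
    have "((\<lambda>s. norm (?g (0 + s) - ?g 0 - s *\<^sub>R torus_deriv f h \<theta>) / norm s) \<longlongrightarrow> 0) (at 0)"
      using line[of "rep_torus \<theta>" 0] unfolding has_derivative_at by simp
    moreover have "filterlim t (at 0) sequentially"
    proof -
      have "t = (\<lambda>k. inverse (real (Suc k)))"
        by (auto simp: t_def inverse_eq_divide add.commute)
      then have "t \<longlonglongrightarrow> 0"
        using LIMSEQ_inverse_real_of_nat by simp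
      then show ?thesis
        using t[THEN less_imp_neq, THEN not_sym] by (simp add: filterlim_at)
    qed
    ultimately have "(\<lambda>k. norm (?g (0 + t k) - ?g 0 - t k *\<^sub>R torus_deriv f h \<theta>) / norm (t k)) \<longlonglongrightarrow> 0"
      by (rule filterlim_compose)
    moreover have "norm (?g (0 + t k) - ?g 0 - t k *\<^sub>R torus_deriv f h \<theta>) / norm (t k)
        = norm (X k \<theta> - torus_deriv f h \<theta>)" for k
    proof -
      have "?g (0 + t k) - ?g 0 - t k *\<^sub>R torus_deriv f h \<theta> = t k *\<^sub>R (X k \<theta> - torus_deriv f h \<theta>)"
        using t[of k] torus_translate_to_torus[of "rep_torus \<theta>" "t k *\<^sub>R h"]
        by (simp add: X_def scaleR_diff_right)
      then show ?thesis using t[of k] by simp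
    qed
    ultimately have "(\<lambda>k. norm (X k \<theta> - torus_deriv f h \<theta>)) \<longlonglongrightarrow> 0"
      by (simp only:)
    then show ?thesis
      by (simp only: tendsto_norm_zero_iff LIM_zero_iff)
  qed
  have meas: "f \<in> borel_measurable borel" "torus_deriv f h \<in> borel_measurable borel"
    "(\<lambda>\<theta>. f (torus_translate \<theta> w)) \<in> borel_measurable borel" for w
    by (intro borel_measurable_continuous_onI cont
        continuous_on_compose2[OF cont(1) continuous_on_torus_translate] subset_UNIV)+
  have int: "integrable torus_lebesgue f" "integrable torus_lebesgue (\<lambda>\<theta>. f (torus_translate \<theta> w))" for w
    by (intro integrable_torus_continuous cont
        continuous_on_compose2[OF cont(1) continuous_on_torus_translate] subset_UNIV)+
  have "(\<lambda>k. LINT \<theta>|torus_lebesgue. X k \<theta>) \<longlonglongrightarrow> (LINT \<theta>|torus_lebesgue. torus_deriv f h \<theta>)"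
  proof (rule integral_dominated_convergence[where w = "\<lambda>_. B"])
    show "X k \<in> borel_measurable torus_lebesgue" for k
      using meas unfolding X_def by measurable
  qed (use meas lim bound in auto)
  moreover have "(LINT \<theta>|torus_lebesgue. X k \<theta>) = 0" for k
    using int by (simp add: X_def integral_torus_translate[OF meas(1)])
  ultimately show ?thesis
    by (simp add: LIMSEQ_const_iff)
qed

lemma torus_Ck_fun_mult:
  fixes f g :: "'n::finite torus \<Rightarrow> 'b::real_normed_algebra"
  shows "torus_Ck_fun k f \<Longrightarrow> torus_Ck_fun k g \<Longrightarrow> torus_Ck_fun k (\<lambda>\<theta>. f \<theta> * g \<theta>)"
  unfolding torus_Ck_fun_def by (rule Ck_on_mult)

lemma torus_deriv_mult:
  fixes f g :: "'n::finite torus \<Rightarrow> 'b::real_normed_algebra"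
  assumes "torus_Ck_fun (Suc k) f" "torus_Ck_fun (Suc k) g"
  shows "torus_deriv (\<lambda>\<theta>. f \<theta> * g \<theta>) h \<theta> = f \<theta> * torus_deriv g h \<theta> + torus_deriv f h \<theta> * g \<theta>"
  using torus_deriv_eqI[OF has_derivative_mult[OF torus_Ck_fun_has_derivative[OF assms(1)]
      torus_Ck_fun_has_derivative[OF assms(2)]], of _ "rep_torus \<theta>"] by simp

text \<open>
  Integration by parts: the derivative of \<open>f \<cdot> e\<^bsup>-i n\<cdot>\<theta>\<^esup>\<close> has integral zero.
\<close>

lemma torus_fourier_deriv:
  assumes f: "torus_Ck_fun (Suc k) f"
  shows "torus_fourier (torus_deriv f h) n = \<i> * of_real (int_vec n \<bullet> h) * torus_fourier f n"
proof -
  let ?e = "torus_char (- n)"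
  have f1: "torus_Ck_fun (Suc 0) f"
    using f by (rule torus_Ck_fun_mono) simp
  have c: "continuous_on UNIV f" "continuous_on UNIV (torus_deriv f h)"
    using f torus_Ck_fun_deriv[OF f] by (auto intro: torus_Ck_fun_continuous)
  have "0 = (LINT \<theta>|torus_lebesgue. torus_deriv (\<lambda>\<theta>. f \<theta> * ?e \<theta>) h \<theta>)"
    by (rule integral_torus_deriv[symmetric]) (intro torus_Ck_fun_mult f1 torus_Ck_fun_char)
  also have "\<dots> = (LINT \<theta>|torus_lebesgue.
      torus_deriv f h \<theta> * ?e \<theta> - (\<i> * of_real (int_vec n \<bullet> h)) * (f \<theta> * ?e \<theta>))"
    by (simp add: torus_deriv_mult[OF f1 torus_Ck_fun_char] torus_deriv_char int_vec_minus mult_ac)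
  also have "\<dots> = (LINT \<theta>|torus_lebesgue. torus_deriv f h \<theta> * ?e \<theta>)
      - (\<i> * of_real (int_vec n \<bullet> h)) * (LINT \<theta>|torus_lebesgue. f \<theta> * ?e \<theta>)"
    by (subst Bochner_Integration.integral_diff)
       (auto intro!: integrable_torus_continuous continuous_on_mult c continuous_on_torus_char)
  finally show ?thesis
    by (simp add: torus_fourier_def)
qed

lemma norm_torus_char [simp]: "norm (torus_char n \<theta>) = 1"
  by transfer simp

lemma norm_torus_fourier_le:
  assumes "continuous_on UNIV f" "\<And>\<theta>. norm (f \<theta>) \<le> B"
  shows "norm (torus_fourier f (n :: int ^ 'n::finite)) \<le> B"
proof -
  have "norm (LINT \<theta>|torus_lebesgue. f \<theta> * torus_char (- n) \<theta>)
      \<le> (LINT \<theta>|torus_lebesgue. norm (f \<theta> * torus_char (- n) \<theta>))"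
    by (rule integral_norm_bound)
  also have "\<dots> \<le> (LINT (\<theta>::'n torus)|torus_lebesgue. B)"
    by (rule integral_mono)
       (use assms in \<open>auto intro!: integrable_torus_continuous continuous_on_mult continuous_on_norm
          continuous_on_torus_char continuous_on_const simp: norm_mult\<close>)
  finally have "norm (LINT \<theta>|torus_lebesgue. f \<theta> * torus_char (- n) \<theta>)
      \<le> (LINT (\<theta>::'n torus)|torus_lebesgue. B)" .
  then show ?thesis
    by (simp add: torus_fourier_def norm_divide norm_mult norm_power measure_torus_UNIV field_simps)
qed

text \<open>
  Each derivative along the \<open>i\<close>-th axis multiplies the \<open>n\<close>-th coefficient by \<open>\<i> n\<^sub>i\<close>, and the
  coefficients of a continuous function are bounded.
\<close>

lemma torus_fourier_coordinate_decay:
  assumes "torus_Ck_fun k f"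
  shows "\<exists>C. \<forall>n. \<bar>of_int (n $ i)\<bar> ^ k * norm (torus_fourier f n) \<le> C"
  using assms
proof (induction k arbitrary: f)
  case 0
  then have c: "continuous_on UNIV f" by (simp add: torus_Ck_fun_0)
  obtain B where "\<And>\<theta>. norm (f \<theta>) \<le> B"
    using bounded_torus_fun[OF c] by metis
  then show ?case
    using norm_torus_fourier_le[OF c] by auto
next
  case (Suc k)
  obtain C where C: "\<And>n. \<bar>of_int (n $ i)\<bar> ^ k * norm (torus_fourier (torus_deriv f (axis i 1)) n) \<le> C"
    using Suc.IH[OF torus_Ck_fun_deriv[OF Suc.prems]] by blast
  have "\<bar>of_int (n $ i)\<bar> ^ Suc k * norm (torus_fourier f n) \<le> C" for n
    using C[of n] by (simp add: torus_fourier_deriv[OF Suc.prems] norm_mult inner_axis mult_ac)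
  then show ?case by blast
qed

lemma torus_fourier_decay:
  fixes f :: "'n::finite torus \<Rightarrow> complex"
  assumes "torus_Ck_fun k f"
  obtains C where "0 < C" "\<And>n. norm (int_vec n) ^ k * norm (torus_fourier f n) \<le> C"
proof -
  obtain C where C: "\<And>i n. \<bar>of_int (n $ i)\<bar> ^ k * norm (torus_fourier f n) \<le> C i"
    using torus_fourier_coordinate_decay[OF assms] by metis
  define D where "D = real CARD('n) ^ k * (\<Sum>i\<in>UNIV. \<bar>C i\<bar>)"
  have D: "norm (int_vec n) ^ k * norm (torus_fourier f n) \<le> D" for n
  proof -
    \<comment> \<open>The bound along the axis of a largest entry controls the full norm.\<close>
    obtain j where j: "\<And>i. \<bar>n $ i\<bar> \<le> \<bar>n $ j\<bar>"
      using  Max_in[of "range (\<lambda>i. \<bar>n $ i\<bar>)"] Max_ge[of "range (\<lambda>i. \<bar>n $ i\<bar>)"] by fastforce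
    have "norm (int_vec n) \<le> (\<Sum>i\<in>UNIV. \<bar>int_vec n $ i\<bar>)"
      by (rule norm_le_l1_cart)
    also have "\<dots> \<le> (\<Sum>i\<in>(UNIV :: 'n set). \<bar>of_int (n $ j)\<bar>)"
      using j by (intro sum_mono) (simp flip: of_int_abs)
    finally have "norm (int_vec n) \<le> real CARD('n) * \<bar>of_int (n $ j)\<bar>"
      by simp
    then have "norm (int_vec n) ^ k * norm (torus_fourier f n)
        \<le> (real CARD('n) * \<bar>of_int (n $ j)\<bar>) ^ k * norm (torus_fourier f n)"
      by (intro mult_right_mono power_mono) auto
    also have "\<dots> = real CARD('n) ^ k * (\<bar>of_int (n $ j)\<bar> ^ k * norm (torus_fourier f n))"
      by (simp add: power_mult_distrib)
    also have "\<dots> \<le> real CARD('n) ^ k * \<bar>C j\<bar>"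
      using C[of n j] by (intro mult_left_mono) auto
    also have "\<dots> \<le> D"
      unfolding D_def by (intro mult_left_mono member_le_sum) auto
    finally show ?thesis .
  qed
  show ?thesis
    by (rule that[of "\<bar>D\<bar> + 1"]) (auto intro: order_trans[OF D])
qed


section \<open>Uniqueness theorems for Fourier coefficients\<close>

text \<open>
  The inductive form lets products be treated by rule induction, without choosing a finite set of
  frequencies.
\<close>

inductive trig_poly :: "('n::finite torus \<Rightarrow> complex) \<Rightarrow> bool" where
  monomial: "trig_poly (\<lambda>\<theta>. c * torus_char n \<theta>)"
| add: "trig_poly f \<Longrightarrow> trig_poly g \<Longrightarrow> trig_poly (\<lambda>\<theta>. f \<theta> + g \<theta>)"

lemma torus_char_0 [simp]: "torus_char 0 \<theta> = 1"
  by transfer simp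

lemma torus_char_add: "torus_char (k + l) \<theta> = torus_char k \<theta> * torus_char l \<theta>"
  by transfer (simp add: int_vec_add inner_add_left cis_mult)

lemma trig_poly_mult:
  assumes "trig_poly f" "trig_poly g"
  shows "trig_poly (\<lambda>\<theta>. f \<theta> * g \<theta>)"
  using assms(1)
proof induction
  case (monomial c n)
  show ?case
    using assms(2)
  proof induction
    case (monomial d k)
    then show ?case
      using trig_poly.monomial[of "c * d" "n + k"] by (simp add: torus_char_add mult_ac)
  next
    case (add f g)
    then show ?case
      using trig_poly.add[OF add.IH] by (simp add: distrib_left)
  qed
next
  case (add f g)
  then show ?case
    using trig_poly.add[OF add.IH] by (simp add: distrib_right)
qed

lemma trig_poly_continuous: "trig_poly f \<Longrightarrow> continuous_on UNIV f"
  by (induction rule: trig_poly.induct)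
     (auto intro!: continuous_on_add continuous_on_mult continuous_on_const continuous_on_torus_char)

lemma trig_poly_Re_char: "trig_poly (\<lambda>\<theta>. of_real (Re (torus_char n \<theta>)))"
  and trig_poly_Im_char: "trig_poly (\<lambda>\<theta>. of_real (Im (torus_char n \<theta>)))"
proof -
  have "of_real (Re z) = 1/2 * z + 1/2 * cnj z" "of_real (Im z) = (- \<i> / 2) * z + (\<i> / 2) * cnj z" for z
    by (simp_all add: complex_eq_iff)
  note eq = this[where z = "torus_char n _", unfolded cnj_torus_char]
  show "trig_poly (\<lambda>\<theta>. of_real (Re (torus_char n \<theta>)))"
    "trig_poly (\<lambda>\<theta>. of_real (Im (torus_char n \<theta>)))"
    unfolding eq by (intro trig_poly.intros)+
qed

text \<open>
  The Stone-Weierstrass theorem for the real algebra of real-valued trigonometric polynomials. The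
  real and imaginary parts of the coordinate characters separate points.
\<close>

lemma trig_poly_dense:
  fixes g :: "'n::finite torus \<Rightarrow> real"
  assumes "continuous_on UNIV g" "0 < e"
  obtains p where "trig_poly (\<lambda>\<theta>. of_real (p \<theta>))" "\<And>\<theta>. \<bar>g \<theta> - p \<theta>\<bar> < e"
proof -
  let ?R = "{p :: 'n torus \<Rightarrow> real. trig_poly (\<lambda>\<theta>. of_real (p \<theta>))}"
  interpret function_ring_on ?R UNIV
  proof
    show "compact (UNIV :: 'n torus set)" by (rule compact_torus)
    show "continuous_on UNIV f" if "f \<in> ?R" for f
    proof -
      have "continuous_on UNIV (\<lambda>\<theta>. Re (of_real (f \<theta>)))"
        using that by (intro continuous_on_Re trig_poly_continuous) simp
      then show ?thesis by simp
    qed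
    show "(\<lambda>x. f x + g x) \<in> ?R" if "f \<in> ?R" "g \<in> ?R" for f g
      using that by (auto intro: trig_poly.add)
    show "(\<lambda>x. f x * g x) \<in> ?R" if "f \<in> ?R" "g \<in> ?R" for f g
      using that by (auto intro: trig_poly_mult)
    show "(\<lambda>_. c) \<in> ?R" for c
      using trig_poly.monomial[of "of_real c" 0] by simp
    show "\<exists>f\<in>?R. f x \<noteq> f y" if neq: "x \<noteq> y" for x y
    proof -
      obtain i where "torus_char (axis i 1) x \<noteq> torus_char (axis i 1) y"
        using torus_char_separates neq by blast
      then consider "Re (torus_char (axis i 1) x) \<noteq> Re (torus_char (axis i 1) y)"
        | "Im (torus_char (axis i 1) x) \<noteq> Im (torus_char (axis i 1) y)"
        by (auto simp: complex_eq_iff)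
      then show ?thesis
      proof cases
        case 1
        then show ?thesis
          by (intro bexI[of _ "\<lambda>\<theta>. Re (torus_char (axis i 1) \<theta>)"]) (auto intro: trig_poly_Re_char)
      next
        case 2
        then show ?thesis
          by (intro bexI[of _ "\<lambda>\<theta>. Im (torus_char (axis i 1) \<theta>)"]) (auto intro: trig_poly_Im_char)
      qed
    qed
  qed
  show ?thesis
    using Stone_Weierstrass_basic[OF assms] that by auto
qed

lemma integral_trig_poly_eq_0:
  fixes d :: "'n::finite torus \<Rightarrow> complex"
  assumes d: "continuous_on UNIV d" and "\<And>n. torus_fourier d n = 0" and "trig_poly p"
  shows "(LINT \<theta>|torus_lebesgue. d \<theta> * p \<theta>) = 0"
  using assms(3)
proof induction
  case (monomial c n)
  have "(LINT \<theta>|torus_lebesgue. d \<theta> * torus_char n \<theta>) = 0"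
    using assms(2)[of "- n"] by (simp add: torus_fourier_def)
  then show ?case
    by (simp add: mult.left_commute[of _ c])
next
  case (add f g)
  then show ?case
    using d by (simp add: distrib_left integrable_torus_continuous continuous_on_mult trig_poly_continuous)
qed

lemma integral_continuous_eq_0:
  fixes d :: "'n::finite torus \<Rightarrow> complex" and g :: "'n torus \<Rightarrow> real"
  assumes d: "continuous_on UNIV d" and "\<And>n. torus_fourier d n = 0" and g: "continuous_on UNIV g"
  shows "(LINT \<theta>|torus_lebesgue. d \<theta> * of_real (g \<theta>)) = 0"
proof -
  obtain B where B: "0 < B" "\<And>\<theta>. norm (d \<theta>) \<le> B"
    using bounded_torus_fun[OF d] by metis
  define V where "V = (2 * pi) ^ CARD('n)"
  have V: "0 < V" by (simp add: V_def)
  have "norm (LINT \<theta>|torus_lebesgue. d \<theta> * of_real (g \<theta>)) \<le> e" if "0 < e" for e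
  proof -
    have "0 < e / (B * V)" using that B V by simp
    then obtain p where p: "trig_poly (\<lambda>\<theta>. of_real (p \<theta>))" "\<And>\<theta>. \<bar>g \<theta> - p \<theta>\<bar> < e / (B * V)"
      using trig_poly_dense[OF g] by metis
    have cont: "continuous_on UNIV (\<lambda>\<theta>. d \<theta> * of_real (g \<theta>))" "continuous_on UNIV (\<lambda>\<theta>. d \<theta> * of_real (p \<theta>))"
      by (intro continuous_on_mult d continuous_on_of_real g trig_poly_continuous[OF p(1)])+
    have "(LINT \<theta>|torus_lebesgue. d \<theta> * of_real (g \<theta>))
        = (LINT \<theta>|torus_lebesgue. d \<theta> * of_real (g \<theta>) - d \<theta> * of_real (p \<theta>))"
      by (subst Bochner_Integration.integral_diff)
         (simp_all add: integrable_torus_continuous cont integral_trig_poly_eq_0[OF assms(1,2) p(1)])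
    also have "norm \<dots> \<le> (LINT \<theta>|torus_lebesgue. norm (d \<theta> * of_real (g \<theta>) - d \<theta> * of_real (p \<theta>)))"
      by (rule integral_norm_bound)
    also have "\<dots> \<le> (LINT (\<theta>::'n torus)|torus_lebesgue. B * (e / (B * V)))"
    proof (rule integral_mono)
      show "norm (d \<theta> * of_real (g \<theta>) - d \<theta> * of_real (p \<theta>)) \<le> B * (e / (B * V))" for \<theta>
      proof -
        have "norm (d \<theta> * of_real (g \<theta>) - d \<theta> * of_real (p \<theta>)) = norm (d \<theta>) * \<bar>g \<theta> - p \<theta>\<bar>"
          by (simp flip: right_diff_distrib of_real_diff add: norm_mult)
        also have "\<dots> \<le> B * (e / (B * V))"
          using B p(2)[of \<theta>] by (intro mult_mono) auto
        finally show ?thesis .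
      qed
    qed (auto intro!: integrable_torus_continuous continuous_on_norm continuous_on_diff cont continuous_on_const)
    also have "\<dots> = e"
      using B V by (simp add: measure_torus_UNIV V_def)
    finally show ?thesis .
  qed
  then show ?thesis
    using field_le_epsilon[of "norm (LINT \<theta>|torus_lebesgue. d \<theta> * of_real (g \<theta>))" 0] by simp
qed

text \<open>
  An open null set of the torus lifts to a periodic open set which is null in the fundamental cell,
  hence in every tile, hence everywhere.
\<close>

lemma torus_open_null_imp_empty:
  fixes U :: "'n::finite torus set"
  assumes U: "open U" and null: "emeasure torus_lebesgue U = 0"
  shows "U = {}"
proof -
  let ?V = "to_torus -` U :: (real ^ 'n) set"
  have V: "open ?V" using U by (simp add: open_torus_def)
  then have [measurable]: "?V \<in> sets borel" by simp
  have *: "emeasure lborel (?V \<inter> torus_cell) = 0"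
    using null emeasure_torus_lebesgue[of U] U by simp
  have "emeasure lborel (?V \<inter> {y. y - 0 + (2 * pi) *\<^sub>R int_vec k \<in> torus_cell}) = 0" for k
  proof -
    have "?V \<inter> {y. y - 0 + (2 * pi) *\<^sub>R int_vec k \<in> torus_cell}
        = {y. y + (2 * pi) *\<^sub>R int_vec k \<in> ?V \<inter> torus_cell}"
      by auto
    then show ?thesis
      using * by (simp only:) (subst emeasure_lborel_translate; simp)
  qed
  then have "emeasure lborel ?V = 0"
    using emeasure_eq_sum_tiles[of ?V 0] by simp
  then have "?V \<in> null_sets lebesgue"
    by (intro null_sets_completionI) (simp add: null_sets_def)
  then have "?V = {}"
    using open_not_negligible[OF V] by (auto simp: negligible_iff_null_sets)
  then show ?thesis
    by (metis empty_iff equals0I to_torus_rep vimageI2)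
qed

lemma integral_torus_nonneg_eq_0:
  fixes g :: "'n::finite torus \<Rightarrow> real"
  assumes g: "continuous_on UNIV g" "\<And>\<theta>. 0 \<le> g \<theta>" and "(LINT \<theta>|torus_lebesgue. g \<theta>) = 0"
  shows "g \<theta> = 0"
proof -
  have "AE \<theta> in torus_lebesgue. g \<theta> = 0"
    using integral_nonneg_eq_0_iff_AE[OF integrable_torus_continuous[OF g(1)]] assms by simp
  moreover have op: "open (g -` (- {0}))"
    using g(1) by (intro open_vimage) auto
  ultimately have "emeasure torus_lebesgue (g -` (- {0})) = 0"
    by (subst (asm) AE_iff_null) (auto simp: null_sets_def vimage_def Compl_eq)
  from torus_open_null_imp_empty[OF op this] show ?thesis by auto
qed

text \<open>
  By density of trigonometric polynomials, a function with vanishing coefficients is orthogonal to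
  every real continuous function, in particular to its own real and imaginary parts.
\<close>

lemma torus_fourier_unique:
  fixes d :: "'n::finite torus \<Rightarrow> complex"
  assumes d: "continuous_on UNIV d" and zero: "\<And>n. torus_fourier d n = 0"
  shows "d \<theta> = 0"
proof -
  have parts: "continuous_on UNIV (\<lambda>\<theta>. Re (d \<theta>))" "continuous_on UNIV (\<lambda>\<theta>. Im (d \<theta>))"
    by (intro continuous_on_Re continuous_on_Im d)+
  have int: "integrable torus_lebesgue (\<lambda>\<theta>. d \<theta> * of_real (g \<theta>))" if "continuous_on UNIV g" for g :: "'n torus \<Rightarrow> real"
    by (intro integrable_torus_continuous continuous_on_mult d continuous_on_of_real that)
  have "(LINT \<theta>|torus_lebesgue. Re (d \<theta>) * Re (d \<theta>)) = 0"
    using arg_cong[OF integral_continuous_eq_0[OF d zero parts(1)], of Re]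
      integral_Re[OF int[OF parts(1)]] by simp
  then have "Re (d \<theta>) * Re (d \<theta>) = 0"
    by (intro integral_torus_nonneg_eq_0[of "\<lambda>\<theta>. Re (d \<theta>) * Re (d \<theta>)"] continuous_on_mult parts) auto
  moreover have "(LINT \<theta>|torus_lebesgue. Im (d \<theta>) * Im (d \<theta>)) = 0"
    using arg_cong[OF integral_continuous_eq_0[OF d zero parts(2)], of Im]
      integral_Im[OF int[OF parts(2)]] by simp
  then have "Im (d \<theta>) * Im (d \<theta>) = 0"
    by (intro integral_torus_nonneg_eq_0[of "\<lambda>\<theta>. Im (d \<theta>) * Im (d \<theta>)"] continuous_on_mult parts) auto
  ultimately show ?thesis
    by (simp add: complex_eq_iff)
qed

text \<open>
  Measures with the same Fourier coefficients integrate trigonometric polynomials alike, hence by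
  density also continuous functions, hence by monotone approximation they agree on open sets. The
  approximation of the indicator of \<open>U\<close> uses the distance to the complement of \<open>U\<close>, measured in
  the embedding of the torus in \<open>\<complex>\<^sup>N\<close> given by the coordinate characters.
\<close>

lemma torus_measure_eqI:
  fixes M N :: "'n::finite torus measure"
  assumes "finite_measure M" "finite_measure N"
    and sets: "sets M = sets borel" "sets N = sets borel"
    and char: "\<And>n. (LINT \<theta>|M. torus_char n \<theta>) = (LINT \<theta>|N. torus_char n \<theta>)"
  shows "M = N"
proof -
  interpret M: finite_measure M by fact
  interpret N: finite_measure N by fact
  have space: "space M = UNIV" "space N = UNIV"
    using sets_eq_imp_space_eq[OF sets(1)] sets_eq_imp_space_eq[OF sets(2)] by simp_all
  have int: "integrable M f" "integrable N f" if f: "continuous_on UNIV f"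
    for f :: "'n torus \<Rightarrow> 'b::{banach, second_countable_topology}"
  proof -
    obtain B where B: "\<And>\<theta>. norm (f \<theta>) \<le> B"
      using bounded_torus_fun[OF f] by metis
    have f': "f \<in> borel_measurable borel"
      by (rule borel_measurable_continuous_onI[OF f])
    have "f \<in> borel_measurable M" "f \<in> borel_measurable N"
      using f' by (simp_all add: measurable_cong_sets[OF sets(1)] measurable_cong_sets[OF sets(2)])
    then show "integrable M f" "integrable N f"
      using B by (auto intro: M.integrable_const_bound[of _ B] N.integrable_const_bound[of _ B])
  qed
  have poly: "(LINT \<theta>|M. p \<theta>) = (LINT \<theta>|N. p \<theta>)" if "trig_poly p" for p
    using that
  proof induction
    case (monomial c n)
    then show ?case by (simp add: char)
  next
    case (add f g)
    then show ?case by (simp add: int trig_poly_continuous)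
  qed
  have cont: "(LINT \<theta>|M. g \<theta>) = (LINT \<theta>|N. g \<theta>)" if g: "continuous_on UNIV g" for g :: "'n torus \<Rightarrow> real"
  proof -
    let ?m = "measure M UNIV + measure N UNIV + 1"
    have m: "0 < ?m" by (simp add: add_nonneg_pos)
    have "\<bar>(LINT \<theta>|M. g \<theta>) - (LINT \<theta>|N. g \<theta>)\<bar> \<le> 0 + e" if e: "0 < e" for e
    proof -
      have "0 < e / ?m" using e m by simp
      then obtain p where p: "trig_poly (\<lambda>\<theta>. of_real (p \<theta>))" "\<And>\<theta>. \<bar>g \<theta> - p \<theta>\<bar> < e / ?m"
        using trig_poly_dense[OF g] by metis
      have "continuous_on UNIV (\<lambda>\<theta>. Re (of_real (p \<theta>)))"
        by (intro continuous_on_Re trig_poly_continuous p(1))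
      then have pc: "continuous_on UNIV p" by simp
      have eq: "(LINT \<theta>|M. p \<theta>) = (LINT \<theta>|N. p \<theta>)"
        using poly[OF p(1)] by (simp add: of_real_eq_iff)
      have est: "\<bar>(LINT \<theta>|L. g \<theta>) - (LINT \<theta>|L. p \<theta>)\<bar> \<le> measure L UNIV * (e / ?m)"
        if L: "finite_measure L" "space L = UNIV"
          and I: "\<And>f :: 'n torus \<Rightarrow> real. continuous_on UNIV f \<Longrightarrow> integrable L f" for L
      proof -
        interpret L: finite_measure L by fact
        have "\<bar>(LINT \<theta>|L. g \<theta>) - (LINT \<theta>|L. p \<theta>)\<bar> = \<bar>LINT \<theta>|L. g \<theta> - p \<theta>\<bar>"
          using I g pc by simp
        also have "\<dots> \<le> (LINT \<theta>|L. \<bar>g \<theta> - p \<theta>\<bar>)"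
          by (rule integral_abs_bound)
        also have "\<dots> \<le> (LINT \<theta>|L. e / ?m)"
          using p(2) by (intro integral_mono I continuous_on_rabs continuous_on_diff g pc continuous_on_const) (simp add: less_imp_le)
        also have "\<dots> = measure L UNIV * (e / ?m)"
          using L by simp
        finally show ?thesis .
      qed
      have "\<bar>(LINT \<theta>|M. g \<theta>) - (LINT \<theta>|N. g \<theta>)\<bar> \<le> measure M UNIV * (e / ?m) + measure N UNIV * (e / ?m)"
        using est[OF \<open>finite_measure M\<close> space(1) int(1)] est[OF \<open>finite_measure N\<close> space(2) int(2)] eq by linarith
      also have "\<dots> = (measure M UNIV + measure N UNIV) * (e / ?m)"
        by (rule distrib_right[symmetric])
      also have "\<dots> \<le> ?m * (e / ?m)"
        using e m by (intro mult_right_mono) auto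
      also have "\<dots> = e" using m by simp
      finally show ?thesis by simp
    qed
    from field_le_epsilon[OF this] show ?thesis by simp
  qed
  \<comment> \<open>The case \<open>U = UNIV\<close> is separate, as the distance to the empty set is zero by convention.\<close>
  have whole: "emeasure M UNIV = emeasure N UNIV"
    using cont[of "\<lambda>_. 1"] space by (simp add: M.emeasure_eq_measure N.emeasure_eq_measure continuous_on_const)
  have opens: "emeasure M U = emeasure N U" if U: "open U" for U
  proof (cases "U = UNIV")
    case False
    define E :: "'n torus \<Rightarrow> complex ^ 'n" where "E \<theta> = (\<chi> i. torus_char (axis i 1) \<theta>)" for \<theta>
    have E: "continuous_on UNIV E"
      unfolding E_def by (intro continuous_on_vec_lambda continuous_on_torus_char)
    have "inj E"
      by (rule injI, rule torus_char_separates) (simp add: E_def vec_eq_iff)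
    have "compact (- U)"
      using compact_Int_closed[OF compact_torus, of "- U"] U by (simp add: closed_Compl)
    then have "compact (E ` (- U))"
      by (rule compact_continuous_image[OF continuous_on_subset[OF E subset_UNIV]])
    then have cl: "closed (E ` (- U))" "E ` (- U) \<noteq> {}"
      using False by (auto intro: compact_imp_closed)
    define D where "D \<theta> = infdist (E \<theta>) (E ` (- U))" for \<theta>
    have D: "continuous_on UNIV D"
      unfolding D_def by (intro continuous_on_infdist E)
    have Dpos: "0 \<le> D \<theta>" for \<theta>
      by (simp add: D_def infdist_nonneg)
    have D0: "D \<theta> = 0 \<longleftrightarrow> \<theta> \<notin> U" for \<theta>
      unfolding D_def in_closed_iff_infdist_zero[OF cl, symmetric] inj_image_mem_iff[OF \<open>inj E\<close>]
      by simp
    \<comment> \<open>Continuous functions increasing to the indicator of \<open>U\<close>.\<close>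
    define g where "g k \<theta> = min 1 (real k * D \<theta>)" for k \<theta>
    have g: "continuous_on UNIV (g k)" for k
      unfolding g_def by (intro continuous_on_min continuous_on_mult continuous_on_const D)
    have lim: "(\<lambda>k. g k \<theta>) \<longlonglongrightarrow> indicator U \<theta>" for \<theta>
    proof (cases "\<theta> \<in> U")
      case True
      then have "0 < D \<theta>" using D0[of \<theta>] Dpos[of \<theta>] by linarith
      then obtain k0 where "1 / D \<theta> < real k0"
        using reals_Archimedean2 by blast
      then have "g k \<theta> = 1" if "k0 \<le> k" for k
      proof -
        have "1 < real k0 * D \<theta>" using \<open>1 / D \<theta> < real k0\<close> \<open>0 < D \<theta>\<close> by (simp add: divide_less_eq)
        also have "\<dots> \<le> real k * D \<theta>" using that Dpos[of \<theta>] by (intro mult_right_mono) auto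
        finally show ?thesis by (simp add: g_def)
      qed
      then show ?thesis
        using True by (intro tendsto_eventually) (auto simp: eventually_sequentially)
    next
      case False
      then show ?thesis using D0[of \<theta>] by (simp add: g_def)
    qed
    have conv: "(\<lambda>k. LINT \<theta>|L. g k \<theta>) \<longlonglongrightarrow> measure L U"
      if L: "finite_measure L" "sets L = sets borel" for L
    proof -
      interpret L: finite_measure L by fact
      have [measurable_cong]: "sets L = sets borel" by fact
      have [measurable]: "g k \<in> borel_measurable borel" for k
        by (rule borel_measurable_continuous_onI[OF g])
      have [measurable]: "U \<in> sets borel" using U by simp
      have "(\<lambda>k. LINT \<theta>|L. g k \<theta>) \<longlonglongrightarrow> (LINT \<theta>|L. indicator U \<theta>)"
      proof (rule integral_dominated_convergence[where w = "\<lambda>_. 1"])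
        show "AE \<theta> in L. norm (g k \<theta>) \<le> 1" for k
          using Dpos by (auto simp: g_def)
      qed (use lim in auto)
      then show ?thesis
        using L U sets_eq_imp_space_eq[OF L(2)] by simp
    qed
    have "measure M U = measure N U"
      using conv[OF \<open>finite_measure M\<close> sets(1)] conv[OF \<open>finite_measure N\<close> sets(2)]
      unfolding cont[OF g] by (rule LIMSEQ_unique)
    then show ?thesis
      by (simp add: M.emeasure_eq_measure N.emeasure_eq_measure)
  qed (use whole in simp)
  show ?thesis
  proof (rule measure_eqI_generator_eq[where E = "{U. open U}" and \<Omega> = UNIV and A = "\<lambda>_. UNIV"])
    show "Int_stable {U :: 'n torus set. open U}"
      by (auto simp: Int_stable_def)
    show "sets M = sigma_sets UNIV {U. open U}" "sets N = sigma_sets UNIV {U. open U}"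
      unfolding sets by (simp_all add: borel_def)
  qed (use opens in auto)
qed


section \<open>Absolutely convergent trigonometric series\<close>

lemma summable_on_int_powr:
  assumes "1 < p"
  shows "(\<lambda>j::int. (1 + \<bar>real_of_int j\<bar>) powr (- p)) summable_on UNIV"
proof -
  let ?f = "\<lambda>j::int. (1 + \<bar>real_of_int j\<bar>) powr (- p)"
  have s: "summable (\<lambda>k::nat. real k powr (- p))"
    using assms by (simp add: summable_real_powr_iff)
  have "(\<lambda>k::nat. real (k + 1) powr (- p)) summable_on UNIV" "(\<lambda>k::nat. real (k + 2) powr (- p)) summable_on UNIV"
    using summable_ignore_initial_segment[OF s, of 1] summable_ignore_initial_segment[OF s, of 2]
    by (auto intro!: summable_nonneg_imp_summable_on)
  moreover have "?f (int k) = real (k + 1) powr (- p)" "?f (- 1 - int k) = real (k + 2) powr (- p)" for k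
    by (auto simp: add.commute algebra_simps)
  ultimately have "(?f \<circ> int) summable_on UNIV" "(?f \<circ> (\<lambda>k. - 1 - int k)) summable_on UNIV"
    by (simp_all add: o_def)
  then have "?f summable_on range int" "?f summable_on range (\<lambda>k. - 1 - int k)"
    by (subst summable_on_reindex; simp add: inj_on_def)+
  then have "?f summable_on (range int \<union> range (\<lambda>k. - 1 - int k))"
    by (rule summable_on_Un_disjoint) auto
  moreover have "range int \<union> range (\<lambda>k. - 1 - int k) = UNIV"
  proof (intro set_eqI iffI UNIV_I)
    fix j :: int
    show "j \<in> range int \<union> range (\<lambda>k. - 1 - int k)"
    proof (cases "0 \<le> j")
      case True
      then have "j = int (nat j)" by simp
      then show ?thesis by blast
    next
      case False
      then have "j = - 1 - int (nat (- 1 - j))" by simp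
      then show ?thesis by blast
    qed
  qed
  ultimately show ?thesis by simp
qed

text \<open>
  Since \<open>1 + \<bar>n\<^sub>i\<bar> \<le> 1 + \<bar>n\<bar>\<close> for each of the \<open>N\<close> coordinates, the summand is at most the product of
  the one-dimensional terms \<open>(1 + \<bar>n\<^sub>i\<bar>)\<^bsup>-s/N\<^esup>\<close>, whose exponent \<open>s/N\<close> exceeds one.
\<close>

lemma summable_on_lattice_powr:
  assumes "real CARD('n) < s"
  shows "(\<lambda>n::int ^ 'n. (1 + norm (int_vec n)) powr (- s)) summable_on UNIV"
proof -
  define p where "p = s / real CARD('n)"
  have p: "1 < p" "s = real CARD('n) * p"
    using assms by (simp_all add: p_def)
  let ?g = "\<lambda>j::int. (1 + \<bar>real_of_int j\<bar>) powr (- p)"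
  have "Infinite_Set_Sum.abs_summable_on (\<lambda>g. \<Prod>i\<in>(UNIV :: 'n set). ?g (g i)) (PiE UNIV (\<lambda>_. UNIV))"
    by (rule Infinite_Set_Sum.abs_summable_on_prod_PiE)
       (use summable_on_int_powr[OF p(1)] in \<open>auto simp flip: abs_summable_equivalent\<close>)
  then have "(\<lambda>g. norm (\<Prod>i\<in>(UNIV :: 'n set). ?g (g i))) summable_on UNIV"
    by (simp add: PiE_UNIV_domain flip: abs_summable_equivalent)
  then have "(\<lambda>g. \<Prod>i\<in>(UNIV :: 'n set). ?g (g i)) summable_on UNIV"
    by (simp add: abs_prod)
  moreover have "bij (vec_nth :: int ^ 'n \<Rightarrow> 'n \<Rightarrow> int)"
    by (rule bij_betw_byWitness[where f' = vec_lambda]) auto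
  ultimately have "(\<lambda>n::int ^ 'n. \<Prod>i\<in>UNIV. ?g (n $ i)) summable_on UNIV"
    using summable_on_reindex_bij_betw[of "vec_nth :: int ^ 'n \<Rightarrow> 'n \<Rightarrow> int" UNIV UNIV "\<lambda>g. \<Prod>i\<in>UNIV. ?g (g i)"] by simp
  then show ?thesis
  proof (rule summable_on_comparison_test)
    fix n :: "int ^ 'n"
    have "1 + norm (int_vec n) \<noteq> 0"
      using norm_ge_zero[of "int_vec n"] by linarith
    then have "(1 + norm (int_vec n)) powr (- s) = (\<Prod>i\<in>(UNIV :: 'n set). (1 + norm (int_vec n)) powr (- p))"
      using p(2) by (simp add: powr_power mult.commute)
    also have "\<dots> \<le> (\<Prod>i\<in>UNIV. ?g (n $ i))"
    proof (rule prod_mono, intro conjI)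
      fix i
      \<comment> \<open>Negative powers reverse the comparison of the bases.\<close>
      have "\<bar>int_vec n $ i\<bar> \<le> norm (int_vec n)" by (rule component_le_norm_cart)
      then show "(1 + norm (int_vec n)) powr (- p) \<le> ?g (n $ i)"
        using p(1) by (intro powr_mono2') auto
    qed auto
    finally show "(1 + norm (int_vec n)) powr (- s) \<le> (\<Prod>i\<in>UNIV. ?g (n $ i))" .
  qed auto
qed

definition trig_series :: "(int ^ 'n \<Rightarrow> complex) \<Rightarrow> 'n::finite torus \<Rightarrow> complex" where
  "trig_series c \<theta> = (\<Sum>\<^sub>\<infinity>n. c n * torus_char n \<theta>)"

text \<open>
  Enumerating the frequencies turns unordered sums over the lattice into ordinary series, for which
  the Weierstrass test and the theorems on termwise differentiation and integration are available.
\<close>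

lemma obtain_lattice_enumeration:
  obtains e :: "nat \<Rightarrow> int ^ 'n::finite" where "bij e"
proof -
  have "inj (\<lambda>j. (\<chi> i. j) :: int ^ 'n)"
    by (auto simp: inj_def vec_eq_iff)
  then have "infinite (UNIV :: (int ^ 'n) set)"
    using range_inj_infinite infinite_super infinite_UNIV_int finite_imageD by (metis subset_UNIV)
  then show ?thesis
    using that bij_betw_from_nat_into[of "UNIV :: (int ^ 'n) set"] by simp
qed

lemma summable_lattice_enumeration:
  assumes "bij e" "f summable_on UNIV"
  shows "summable (\<lambda>k::nat. f (e k) :: real)"
  using assms summable_on_reindex_bij_betw[of e UNIV UNIV f] by (auto intro: summable_on_imp_summable)

lemma trig_series_sums:
  assumes "bij e" "(\<lambda>n. norm (c n)) summable_on UNIV"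
  shows "(\<lambda>k. c (e k) * torus_char (e k) \<theta>) sums trig_series c \<theta>"
proof -
  have abs: "summable (\<lambda>k. norm (c (e k) * torus_char (e k) \<theta>))"
    using summable_lattice_enumeration[OF assms] by (simp add: norm_mult)
  note sums = summable_sums[OF summable_norm_cancel[OF abs]]
  have "(\<lambda>k. c (e k) * torus_char (e k) \<theta>) sums (\<Sum>\<^sub>\<infinity>k. c (e k) * torus_char (e k) \<theta>)"
    using sums infsumI[OF norm_summable_imp_has_sum[OF abs sums]] by simp
  then show ?thesis
    using infsum_reindex_bij_betw[OF assms(1), of "\<lambda>n. c n * torus_char n \<theta>"]
    by (simp add: trig_series_def)
qed

lemma summable_on_weight_mono:
  fixes c :: "int ^ 'n::finite \<Rightarrow> complex"
  assumes "(\<lambda>n. norm (c n) * (1 + norm (int_vec n)) ^ k) summable_on UNIV" "j \<le> k"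
  shows "(\<lambda>n. norm (c n) * (1 + norm (int_vec n)) ^ j) summable_on UNIV"
  using assms(1)
  by (rule summable_on_comparison_test) (auto intro!: mult_left_mono power_increasing assms(2))

lemma abs_inner_le_weight: "\<bar>u \<bullet> h\<bar> \<le> norm h * (1 + norm u)"
proof -
  have "\<bar>u \<bullet> h\<bar> \<le> norm u * norm h" by (rule Cauchy_Schwarz_ineq2)
  also have "\<dots> \<le> norm h * (1 + norm u)" by (simp add: distrib_left mult.commute)
  finally show ?thesis .
qed

text \<open>
  Differentiating a trigonometric series along \<open>h\<close> multiplies its coefficients by \<open>\<i> n\<cdot>h\<close>, which
  costs one power of the weight \<open>1 + \<bar>n\<bar>\<close>.
\<close>

lemma summable_on_weight_deriv:
  fixes c :: "int ^ 'n::finite \<Rightarrow> complex"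
  assumes "(\<lambda>n. norm (c n) * (1 + norm (int_vec n)) ^ Suc k) summable_on UNIV"
  shows "(\<lambda>n. norm (\<i> * of_real (int_vec n \<bullet> h) * c n) * (1 + norm (int_vec n)) ^ k) summable_on UNIV"
proof (rule summable_on_comparison_test[OF summable_on_cmult_right[OF assms, of "norm h"]])
  fix n :: "int ^ 'n"
  have "\<bar>int_vec n \<bullet> h\<bar> \<le> norm h * (1 + norm (int_vec n))"
    by (rule abs_inner_le_weight)
  then have "\<bar>int_vec n \<bullet> h\<bar> * (norm (c n) * (1 + norm (int_vec n)) ^ k)
      \<le> (norm h * (1 + norm (int_vec n))) * (norm (c n) * (1 + norm (int_vec n)) ^ k)"
    by (rule mult_right_mono) simp
  then show "norm (\<i> * of_real (int_vec n \<bullet> h) * c n) * (1 + norm (int_vec n)) ^ k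
      \<le> norm h * (norm (c n) * (1 + norm (int_vec n)) ^ Suc k)"
    by (simp add: norm_mult mult_ac)
qed auto

lemma trig_series_continuous:
  fixes c :: "int ^ 'n::finite \<Rightarrow> complex"
  assumes "(\<lambda>n. norm (c n)) summable_on UNIV"
  shows "continuous_on UNIV (trig_series c)"
proof -
  obtain e :: "nat \<Rightarrow> int ^ 'n" where e: "bij e"
    by (rule obtain_lattice_enumeration)
  have "uniform_limit UNIV (\<lambda>n \<theta>. \<Sum>k<n. c (e k) * torus_char (e k) \<theta>)
      (\<lambda>\<theta>. \<Sum>k. c (e k) * torus_char (e k) \<theta>) sequentially"
    by (rule Weierstrass_m_test[OF _ summable_lattice_enumeration[OF e assms]]) (simp add: norm_mult)
  then have "continuous_on UNIV (\<lambda>\<theta>. \<Sum>k. c (e k) * torus_char (e k) \<theta>)"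
    by (rule uniform_limit_theorem[rotated])
       (auto intro!: always_eventually continuous_on_sum continuous_on_mult continuous_on_const continuous_on_torus_char)
  then show ?thesis
    using sums_unique[OF trig_series_sums[OF e assms]] by simp
qed

text \<open>
  Termwise differentiation: the derived series is dominated, uniformly in the base point and
  linearly in the norm of the direction, by the summable weights \<open>\<bar>c\<^sub>n\<bar> (1 + \<bar>n\<bar>)\<close>.
\<close>

lemma trig_series_has_derivative:
  fixes c :: "int ^ 'n::finite \<Rightarrow> complex"
  assumes c: "(\<lambda>n. norm (c n) * (1 + norm (int_vec n))) summable_on UNIV"
  shows "((\<lambda>x. trig_series c (to_torus x)) has_derivative
    (\<lambda>h. trig_series (\<lambda>n. \<i> * of_real (int_vec n \<bullet> h) * c n) (to_torus x))) (at x)"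
proof -
  obtain e :: "nat \<Rightarrow> int ^ 'n" where e: "bij e"
    by (rule obtain_lattice_enumeration)
  let ?c' = "\<lambda>h n. \<i> * of_real (int_vec n \<bullet> h) * c n"
  have c0: "(\<lambda>n. norm (c n)) summable_on UNIV"
    using summable_on_weight_mono[of c 1 0] c by simp
  have c1: "(\<lambda>n. norm (?c' h n)) summable_on UNIV" for h
    using summable_on_weight_deriv[of c 0 h] c by simp
  have M: "summable (\<lambda>k. norm (c (e k)) * (1 + norm (int_vec (e k))))"
    by (rule summable_lattice_enumeration[OF e c])
  define f where "f k x = c (e k) * cis (int_vec (e k) \<bullet> x)" for k x
  define f' where "f' k x h = ?c' h (e k) * cis (int_vec (e k) \<bullet> x)" for k x h
  have f: "(\<lambda>k. f k x) sums trig_series c (to_torus x)" for x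
    using trig_series_sums[OF e c0, of "to_torus x"] by (simp add: f_def torus_char_to_torus)
  have f': "(\<lambda>k. f' k x h) sums trig_series (?c' h) (to_torus x)" for x h
    using trig_series_sums[OF e c1, of h "to_torus x"] by (simp add: f'_def torus_char_to_torus)
  have bound: "norm (f' k x h) \<le> norm h * (norm (c (e k)) * (1 + norm (int_vec (e k))))" for k x h
  proof -
    have "\<bar>int_vec (e k) \<bullet> h\<bar> \<le> norm h * (1 + norm (int_vec (e k)))"
      by (rule abs_inner_le_weight)
    from mult_right_mono[OF this norm_ge_zero[of "c (e k)"]] show ?thesis
      by (simp add: f'_def norm_mult mult_ac)
  qed
  have "\<exists>g. \<forall>x\<in>UNIV. (\<lambda>k. f k x) sums g x \<and>
      (g has_derivative (\<lambda>h. trig_series (?c' h) (to_torus x))) (at x within UNIV)"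
  proof (rule has_derivative_series[OF convex_UNIV])
    show "(f k has_derivative f' k x) (at x within UNIV)" for k x
      unfolding f_def f'_def
      using has_derivative_mult_right[OF has_derivative_cis_inner[of "int_vec (e k)" x], of "c (e k)"]
      by (simp add: mult_ac)
    show "\<forall>\<^sub>F n in sequentially. \<forall>x\<in>UNIV. \<forall>h.
        norm ((\<Sum>k<n. f' k x h) - trig_series (?c' h) (to_torus x)) \<le> r * norm h" if "0 < r" for r
    proof -
      obtain N where N: "\<And>n. N \<le> n \<Longrightarrow>
          norm (\<Sum>k. norm (c (e (k + n))) * (1 + norm (int_vec (e (k + n))))) < r"
        using suminf_exist_split[OF \<open>0 < r\<close> M] by blast
      have "norm ((\<Sum>k<n. f' k x h) - trig_series (?c' h) (to_torus x)) \<le> r * norm h" if "N \<le> n" for n x h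
      proof -
        let ?M = "\<lambda>k. norm (c (e (k + n))) * (1 + norm (int_vec (e (k + n))))"
        have M': "summable ?M"
          using M by (rule summable_ignore_initial_segment)
        have "trig_series (?c' h) (to_torus x) - (\<Sum>k<n. f' k x h) = (\<Sum>k. f' (k + n) x h)"
          using suminf_minus_initial_segment[OF sums_summable[OF f']] sums_unique[OF f'] by metis
        also have "norm \<dots> \<le> (\<Sum>k. norm h * ?M k)"
          by (rule norm_suminf_le[OF bound summable_mult[OF M']])
        also have "\<dots> = norm h * (\<Sum>k. ?M k)"
          by (rule suminf_mult[OF M'])
        also have "\<dots> \<le> norm h * r"
          using N[OF that] by (intro mult_left_mono) auto
        finally show ?thesis
          by (simp add: norm_minus_commute mult.commute)
      qed
      then show ?thesis
        unfolding eventually_sequentially by blast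
    qed
  qed (use f in auto)
  then obtain g where g: "\<And>x. (\<lambda>k. f k x) sums g x"
    "\<And>x. (g has_derivative (\<lambda>h. trig_series (?c' h) (to_torus x))) (at x)"
    by auto
  have "g = (\<lambda>x. trig_series c (to_torus x))"
    using sums_unique2[OF g(1) f] by auto
  then show ?thesis using g(2) by simp
qed

lemma trig_series_Ck:
  fixes c :: "int ^ 'n::finite \<Rightarrow> complex"
  assumes "(\<lambda>n. norm (c n) * (1 + norm (int_vec n)) ^ k) summable_on UNIV"
  shows "torus_Ck_fun k (trig_series c)"
  using assms
proof (induction k arbitrary: c)
  case 0
  then show ?case by (simp add: torus_Ck_fun_0 trig_series_continuous)
next
  case (Suc k)
  have "(\<lambda>n. norm (c n) * (1 + norm (int_vec n))) summable_on UNIV"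
    using summable_on_weight_mono[OF Suc.prems, of 1] by simp
  then show ?case
    by (intro torus_Ck_fun_SucI[where f' = "\<lambda>h. trig_series (\<lambda>n. \<i> * of_real (int_vec n \<bullet> h) * c n)"]
        trig_series_has_derivative Suc.IH summable_on_weight_deriv Suc.prems)
qed

text \<open>
  For \<open>n \<noteq> 0\<close> the derivative of the character in the direction \<open>n\<close>, which has integral zero, is the
  nonzero multiple \<open>\<i> \<bar>n\<bar>\<^sup>2\<close> of the character itself.
\<close>

lemma integral_torus_char:
  fixes n :: "int ^ 'n::finite"
  shows "(LINT \<theta>|torus_lebesgue. torus_char n \<theta>) = (if n = 0 then (2 * pi) ^ CARD('n) else 0)"
proof (cases "n = 0")
  case True
  then show ?thesis by (simp add: measure_torus_UNIV scaleR_conv_of_real)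
next
  case False
  then have "int_vec n \<noteq> 0"
    by (simp add: vec_eq_iff)
  moreover have "(LINT \<theta>|torus_lebesgue. torus_deriv (torus_char n) (int_vec n) \<theta>) = 0"
    by (rule integral_torus_deriv) (rule torus_Ck_fun_char)
  ultimately show ?thesis
    using False by (simp add: torus_deriv_char)
qed

lemma torus_fourier_trig_series:
  fixes c :: "int ^ 'n::finite \<Rightarrow> complex"
  assumes c: "(\<lambda>n. norm (c n)) summable_on UNIV"
  shows "torus_fourier (trig_series c) n = c n"
proof -
  obtain e :: "nat \<Rightarrow> int ^ 'n" where e: "bij e"
    by (rule obtain_lattice_enumeration)
  let ?t = "\<lambda>k \<theta>. c (e k) * torus_char (e k + - n) \<theta>"
  have sum: "summable (\<lambda>k. norm (c (e k)))"
    by (rule summable_lattice_enumeration[OF e c])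
  have "(\<lambda>k. LINT \<theta>|torus_lebesgue. ?t k \<theta>) sums (LINT \<theta>|torus_lebesgue. (\<Sum>k. ?t k \<theta>))"
  proof (rule sums_integral)
    show "integrable torus_lebesgue (?t k)" for k
      by (intro integrable_torus_continuous continuous_on_mult continuous_on_const continuous_on_torus_char)
    show "AE \<theta> in torus_lebesgue. summable (\<lambda>k. norm (?t k \<theta>))"
      using sum by (simp add: norm_mult)
    show "summable (\<lambda>k. LINT \<theta>|torus_lebesgue. norm (?t k \<theta>))"
      using sum by (simp add: norm_mult summable_mult)
  qed
  moreover have "(\<Sum>k. ?t k \<theta>) = trig_series c \<theta> * torus_char (- n) \<theta>" for \<theta>
    using sums_unique[OF sums_mult2[OF trig_series_sums[OF e c, of \<theta>], of "torus_char (- n) \<theta>"]]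
    by (simp only: torus_char_add mult.assoc)
  moreover obtain k0 where k0: "e k0 = n"
    using surjD[OF bij_is_surj[OF e], of n] by metis
  moreover have "(LINT \<theta>|torus_lebesgue. ?t k \<theta>) = (if k = k0 then c n * (2 * pi) ^ CARD('n) else 0)" for k
    using e k0 by (auto simp: integral_torus_char bij_def inj_eq)
  ultimately have "(\<lambda>k. if k = k0 then c n * (2 * pi) ^ CARD('n) else 0) sums
      (LINT \<theta>|torus_lebesgue. trig_series c \<theta> * torus_char (- n) \<theta>)"
    by simp
  moreover have "(\<lambda>k. if k = k0 then c n * (2 * pi) ^ CARD('n) else 0) sums (c n * (2 * pi) ^ CARD('n))"
    using sums_single[of k0 "\<lambda>_. c n * (2 * pi) ^ CARD('n)"] by simp
  ultimately have "(LINT \<theta>|torus_lebesgue. trig_series c \<theta> * torus_char (- n) \<theta>) = c n * (2 * pi) ^ CARD('n)"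
    by (rule sums_unique2)
  then show ?thesis
    by (simp add: torus_fourier_def)
qed


section \<open>The cohomological equation\<close>

lemma torus_Ck_fun_linear_comp:
  "bounded_linear L \<Longrightarrow> torus_Ck_fun k f \<Longrightarrow> torus_Ck_fun k (\<lambda>\<theta>. L (f \<theta>))"
  unfolding torus_Ck_fun_def by (rule Ck_on_linear_comp)

lemma torus_deriv_linear_comp:
  assumes "bounded_linear L" "torus_Ck_fun (Suc k) f"
  shows "torus_deriv (\<lambda>\<theta>. L (f \<theta>)) h \<theta> = L (torus_deriv f h \<theta>)"
  using torus_deriv_eqI[OF bounded_linear.has_derivative[OF assms(1)
      torus_Ck_fun_has_derivative[OF assms(2)]], of h "rep_torus \<theta>"] by simp

lemma torus_fourier_diff:
  assumes "continuous_on UNIV f" "continuous_on UNIV g"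
  shows "torus_fourier (\<lambda>\<theta>. f \<theta> - g \<theta>) n = torus_fourier f n - torus_fourier g n"
  using assms
  by (simp add: torus_fourier_def left_diff_distrib diff_divide_distrib integrable_torus_continuous
      continuous_on_mult continuous_on_torus_char)

text \<open>
  The Fourier coefficients of the zero-mean solution \<open>u\<close> of \<open>w \<cdot> \<nabla>u = f\<close>.
\<close>

definition small_divisor_coeff ::
    "('n::finite torus \<Rightarrow> complex) \<Rightarrow> real ^ 'n \<Rightarrow> int ^ 'n \<Rightarrow> complex" where
  "small_divisor_coeff f w n =
    (if n = 0 then 0 else torus_fourier f n / (\<i> * complex_of_real (int_vec n \<bullet> w)))"

lemma norm_int_vec_ge_1:
  assumes "n \<noteq> (0 :: int ^ 'n::finite)"
  shows "1 \<le> norm (int_vec n)"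
proof -
  obtain i where "n $ i \<noteq> 0" using assms by (auto simp: vec_eq_iff)
  then have "1 \<le> \<bar>n $ i\<bar>" by linarith
  then have "1 \<le> \<bar>int_vec n $ i\<bar>" by (simp flip: of_int_abs)
  also have "\<dots> \<le> norm (int_vec n)" by (rule component_le_norm_cart)
  finally show ?thesis .
qed

lemma diophantine_imp_nonresonant:
  fixes n :: "int ^ 'n::finite"
  assumes "0 < \<alpha>" and "\<alpha> * norm (int_vec n) powr (- \<tau>) \<le> \<bar>int_vec n \<bullet> w\<bar>" and "n \<noteq> 0"
  shows "int_vec n \<bullet> w \<noteq> 0"
proof -
  have "int_vec n \<noteq> 0"
    using norm_int_vec_ge_1[OF assms(3)] by auto
  then have "0 < \<alpha> * norm (int_vec n) powr (- \<tau>)"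
    using assms(1) by simp
  then show ?thesis
    using assms(2) by auto
qed

text \<open>
  The coefficients of \<open>f\<close> decay like \<open>\<bar>n\<bar>\<^bsup>-q\<^esup>\<close> and the small divisors cost at most \<open>\<bar>n\<bar>\<^sup>\<tau>\<close>, so the
  weighted coefficients are of order \<open>\<bar>n\<bar>\<^bsup>-(q - \<tau> - r)\<^esup>\<close>, and \<open>q - \<tau> - r > N\<close>.
\<close>

lemma small_divisor_coeff_summable:
  fixes f :: "'n::finite torus \<Rightarrow> complex"
  assumes f: "torus_Ck_fun q f" and "0 < \<alpha>"
    and dioph: "\<And>n. n \<noteq> 0 \<Longrightarrow> \<alpha> * norm (int_vec n) powr (- \<tau>) \<le> \<bar>int_vec n \<bullet> w\<bar>"
    and r: "real r < real q - \<tau> - real CARD('n)"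
  shows "(\<lambda>n. norm (small_divisor_coeff f w n) * (1 + norm (int_vec n)) ^ r) summable_on UNIV"
proof -
  obtain C where C: "0 < C" "\<And>n. norm (int_vec n) ^ q * norm (torus_fourier f n) \<le> C"
    using torus_fourier_decay[OF f] by metis
  define p where "p = real q - \<tau>"
  have p: "0 \<le> p" using r by (simp add: p_def)
  define K where "K = C / \<alpha> * 2 powr p"
  have K: "0 \<le> K" using C \<open>0 < \<alpha>\<close> by (simp add: K_def)
  have sum: "(\<lambda>n::int ^ 'n. K * (1 + norm (int_vec n)) powr (- (p - real r))) summable_on UNIV"
    using r by (intro summable_on_cmult_right summable_on_lattice_powr) (simp add: p_def)
  then show ?thesis
  proof (rule summable_on_comparison_test)
    fix n :: "int ^ 'n"
    let ?x = "norm (int_vec n)"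
    have quotient: "(C * x powr (- real q)) / (\<alpha> * x powr (- \<tau>)) = C / \<alpha> * x powr (- p)" if "0 < x" for x
      using that \<open>0 < \<alpha>\<close> by (simp add: p_def powr_diff powr_minus field_simps)
    have shift: "x powr (- p) \<le> 2 powr p * (1 + x) powr (- p)" if "1 \<le> x" for x
    proof -
      have "(1 + x) powr p \<le> (2 * x) powr p"
        using that p by (intro powr_mono2) auto
      then show ?thesis
        using that by (simp add: powr_mult powr_minus field_simps)
    qed
    show "norm (small_divisor_coeff f w n) * (1 + ?x) ^ r \<le> K * (1 + ?x) powr (- (p - real r))"
    proof (cases "n = 0")
      case True
      then show ?thesis using K by (simp add: small_divisor_coeff_def)
    next
      case False
      then have x: "1 \<le> ?x" by (rule norm_int_vec_ge_1)
      then have x0: "0 < ?x" "0 < 1 + ?x" by linarith+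
      have "norm (torus_fourier f n) \<le> C * ?x powr (- real q)"
        using C(2)[of n] x0 by (simp add: powr_minus powr_realpow field_simps del: zero_less_norm_iff)
      moreover have pos: "0 < \<alpha> * ?x powr (- \<tau>)"
        using x0 \<open>0 < \<alpha>\<close> by simp
      moreover note dioph[OF False]
      ultimately have "norm (torus_fourier f n) / \<bar>int_vec n \<bullet> w\<bar>
          \<le> (C * ?x powr (- real q)) / (\<alpha> * ?x powr (- \<tau>))"
        using C(1) by (intro frac_le) auto
      also have "\<dots> = C / \<alpha> * ?x powr (- p)"
        by (rule quotient[OF x0(1)])
      also have "\<dots> \<le> C / \<alpha> * (2 powr p * (1 + ?x) powr (- p))"
        using shift[OF x] C(1) \<open>0 < \<alpha>\<close> by (intro mult_left_mono) auto
      finally have "norm (small_divisor_coeff f w n) \<le> K * (1 + ?x) powr (- p)"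
        using False by (simp add: small_divisor_coeff_def norm_divide norm_mult K_def mult_ac)
      then have "norm (small_divisor_coeff f w n) * (1 + ?x) ^ r \<le> K * (1 + ?x) powr (- p) * (1 + ?x) ^ r"
        by (rule mult_right_mono) simp
      also have "\<dots> = K * (1 + ?x) powr (- (p - real r))"
        using x0 by (simp add: powr_realpow[symmetric] flip: powr_add del: zero_less_norm_iff)
      finally show ?thesis .
    qed
  qed auto
qed

text \<open>
  Termwise differentiation along \<open>w\<close> cancels the small divisors and returns the Fourier series of
  \<open>f\<close>, which represents \<open>f\<close> by uniqueness of Fourier coefficients.
\<close>

lemma cohomological_equation:
  fixes f :: "'n::finite torus \<Rightarrow> complex"
  assumes f: "torus_Ck_fun q f" and mean: "torus_fourier f 0 = 0" and "0 < \<alpha>"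
    and dioph: "\<And>n. n \<noteq> 0 \<Longrightarrow> \<alpha> * norm (int_vec n) powr (- \<tau>) \<le> \<bar>int_vec n \<bullet> w\<bar>"
    and r: "1 \<le> r" "real r < real q - \<tau> - real CARD('n)"
  defines "u \<equiv> trig_series (small_divisor_coeff f w)"
  shows "torus_Ck_fun r u" and "torus_deriv u w \<theta> = f \<theta>"
proof -
  let ?c = "small_divisor_coeff f w"
  have c: "(\<lambda>n. norm (?c n) * (1 + norm (int_vec n)) ^ r) summable_on UNIV"
    by (rule small_divisor_coeff_summable[OF f \<open>0 < \<alpha>\<close> dioph r(2)])
  show "torus_Ck_fun r u"
    unfolding u_def by (rule trig_series_Ck[OF c])
  have c1: "(\<lambda>n. norm (?c n) * (1 + norm (int_vec n)) ^ Suc 0) summable_on UNIV"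
    using c r(1) by (intro summable_on_weight_mono[OF c]) simp
  have eq: "\<i> * of_real (int_vec n \<bullet> w) * ?c n = torus_fourier f n" for n
  proof (cases "n = 0")
    case False
    then have "int_vec n \<bullet> w \<noteq> 0"
      by (intro diophantine_imp_nonresonant[OF \<open>0 < \<alpha>\<close> dioph])
    then show ?thesis
      using False by (simp add: small_divisor_coeff_def)
  qed (use mean in \<open>simp add: small_divisor_coeff_def\<close>)
  have fc: "continuous_on UNIV f"
    using f by (rule torus_Ck_fun_continuous)
  have sf: "(\<lambda>n. norm (torus_fourier f n)) summable_on UNIV"
    using summable_on_weight_deriv[OF c1, of w] by (simp only: eq power_0 mult_1_right)
  have inv: "trig_series (torus_fourier f) \<theta> = f \<theta>" for \<theta>
    using torus_fourier_unique[of "\<lambda>\<theta>. trig_series (torus_fourier f) \<theta> - f \<theta>" \<theta>]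
    by (simp add: continuous_on_diff fc trig_series_continuous[OF sf] torus_fourier_diff
        torus_fourier_trig_series[OF sf])
  have "((\<lambda>x. u (to_torus x)) has_derivative
      (\<lambda>h. trig_series (\<lambda>n. \<i> * of_real (int_vec n \<bullet> h) * ?c n) (to_torus x))) (at x)" for x
    unfolding u_def using c1 by (intro trig_series_has_derivative) simp
  from torus_deriv_eqI[OF this, of w "rep_torus \<theta>"] show "torus_deriv u w \<theta> = f \<theta>"
    by (simp add: eq inv)
qed

section \<open>Shears along a constant direction\<close>

text \<open>
  The conjugacy is the shear by the solution of the cohomological equation. The lemmas below treat
  shears by arbitrary smooth functions \<open>v\<close>, in terms of the stretching factor \<open>1 + w \<cdot> \<nabla>v\<close>.
\<close>

definition shear :: "('n::finite torus \<Rightarrow> real) \<Rightarrow> real ^ 'n \<Rightarrow> 'n torus \<Rightarrow> 'n torus" where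
  "shear v w \<theta> = torus_translate \<theta> (v \<theta> *\<^sub>R w)"

definition shear_lift :: "('n::finite torus \<Rightarrow> real) \<Rightarrow> real ^ 'n \<Rightarrow> real ^ 'n \<Rightarrow> real ^ 'n" where
  "shear_lift v w x = x + v (to_torus x) *\<^sub>R w"

lemma shear_to_torus: "shear v w (to_torus x) = to_torus (shear_lift v w x)"
  by (simp add: shear_def shear_lift_def torus_translate_to_torus)

lemma shear_lift_periodic:
  "shear_lift v w (x + (2 * pi) *\<^sub>R int_vec k) = shear_lift v w x + (2 * pi) *\<^sub>R int_vec k"
  by (simp add: shear_lift_def)

lemma shear_lift_has_derivative:
  assumes "torus_Ck_fun (Suc k) v"
  shows "(shear_lift v w has_derivative (\<lambda>h. h + torus_deriv v h (to_torus x) *\<^sub>R w)) (at x)"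
  unfolding shear_lift_def
  by (intro has_derivative_add has_derivative_ident has_derivative_scaleR_left
      torus_Ck_fun_has_derivative[OF assms])

context
  fixes v :: "'n::finite torus \<Rightarrow> real" and w :: "real ^ 'n" and k :: nat
  assumes v: "torus_Ck_fun (Suc k) v" and pos: "\<And>\<theta>. 0 < 1 + torus_deriv v w \<theta>"
begin

lemma shear_line_has_derivative:
  "((\<lambda>t. t + v (to_torus (x + t *\<^sub>R w))) has_real_derivative
    1 + torus_deriv v w (to_torus (x + t *\<^sub>R w))) (at t)"
proof -
  have "((\<lambda>t. v (to_torus (x + t *\<^sub>R w))) has_derivative
      (\<lambda>s. torus_deriv v (s *\<^sub>R w) (to_torus (x + t *\<^sub>R w)))) (at t)"
    by (rule has_derivative_compose[OF _ torus_Ck_fun_has_derivative[OF v]])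
       (auto intro!: derivative_eq_intros)
  moreover have "torus_deriv v (s *\<^sub>R w) (to_torus y) = torus_deriv v w (to_torus y) * s" for s y
    using linear_scale[OF has_derivative_linear[OF torus_Ck_fun_has_derivative[OF v, of y]], of s w]
    by simp
  ultimately have "((\<lambda>t. v (to_torus (x + t *\<^sub>R w))) has_real_derivative
      torus_deriv v w (to_torus (x + t *\<^sub>R w))) (at t)"
    by (simp add: has_field_derivative_def)
  then show ?thesis
    by (intro DERIV_add DERIV_ident)
qed

text \<open>
  The lift maps every line parallel to \<open>w\<close> into itself, acting on it by \<open>t \<mapsto> t + v(x + t w)\<close>. This
  function is strictly increasing as its derivative \<open>1 + w \<cdot> \<nabla>v\<close> is positive, and it is onto, as
  the next lemma shows, since \<open>v\<close> is bounded.
\<close>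

lemma inj_shear_lift: "inj (shear_lift v w)"
proof (rule injI)
  fix x y assume eq: "shear_lift v w x = shear_lift v w y"
  define s where "s = v (to_torus y) - v (to_torus x)"
  have x: "x = y + s *\<^sub>R w"
    using eq by (simp add: shear_lift_def s_def algebra_simps)
  have mono: "a + v (to_torus (y + a *\<^sub>R w)) < b + v (to_torus (y + b *\<^sub>R w))" if "a < b" for a b
    by (rule DERIV_pos_imp_increasing[OF that, of "\<lambda>t. t + v (to_torus (y + t *\<^sub>R w))"])
       (intro exI conjI, rule shear_line_has_derivative, rule pos)
  have "s + v (to_torus (y + s *\<^sub>R w)) = 0 + v (to_torus (y + 0 *\<^sub>R w))"
    unfolding x[symmetric] by (simp add: s_def)
  then have "s = 0"
    using mono[of s 0] mono[of 0 s] by (cases s "0 :: real" rule: linorder_cases) auto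
  then show "x = y" using x by simp
qed

lemma surj_shear_lift: "surj (shear_lift v w)"
proof -
  obtain B where B: "0 < B" "\<And>\<theta>. norm (v \<theta>) \<le> B"
    using bounded_torus_fun[OF torus_Ck_fun_continuous[OF v]] by metis
  have "\<exists>x. shear_lift v w x = y" for y
  proof -
    let ?g = "\<lambda>t. t + v (to_torus (y + t *\<^sub>R w))"
    \<comment> \<open>As \<open>\<bar>v\<bar> \<le> B\<close>, the function \<open>?g\<close> changes sign on \<open>[-B, B]\<close>.\<close>
    have "?g (- B) \<le> 0" "0 \<le> ?g B"
      using B(2)[of "to_torus (y + (- B) *\<^sub>R w)"] B(2)[of "to_torus (y + B *\<^sub>R w)"]
      unfolding real_norm_def abs_le_iff by linarith+
    moreover have "\<forall>t. - B \<le> t \<and> t \<le> B \<longrightarrow> isCont ?g t"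
      using shear_line_has_derivative[of y] DERIV_isCont by blast
    ultimately obtain t where "?g t = 0"
      using IVT[of ?g "- B" 0 B] B(1) by auto
    then have "shear_lift v w (y + t *\<^sub>R w) = y"
      by (simp add: shear_lift_def flip: scaleR_add_left)
    then show ?thesis by blast
  qed
  then show ?thesis by (metis surjI)
qed

text \<open>
  The derivative of the lift is a rank-one perturbation \<open>h \<mapsto> h + (\<nabla>v \<cdot> h) w\<close> of the identity, whose
  inverse is \<open>h \<mapsto> h - (\<nabla>v \<cdot> h) / (1 + w \<cdot> \<nabla>v) w\<close> by the Sherman-Morrison formula. The inverse map
  is continuous by invariance of domain. Writing the reciprocal as a power with exponent \<open>-1\<close>
  makes the smoothness of real powers applicable in the next lemmas.
\<close>

lemma inv_shear_lift_has_derivative: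
  "(inv (shear_lift v w) has_derivative (\<lambda>h. h -
     (torus_deriv v h (to_torus (inv (shear_lift v w) y)) *
      (1 + torus_deriv v w (to_torus (inv (shear_lift v w) y))) powr (- 1)) *\<^sub>R w)) (at y)"
proof -
  let ?\<Phi> = "inv (shear_lift v w)"
  let ?d = "\<lambda>h. torus_deriv v h (to_torus (?\<Phi> y))"
  have "continuous_on UNIV (shear_lift v w)"
    using has_derivative_continuous_on[OF shear_lift_has_derivative[OF v]]
    by (simp add: continuous_on_eq_continuous_within)
  from continuous_on_inverse_open[OF open_UNIV this _ inv_f_f[OF inj_shear_lift]]
  have "continuous_on UNIV ?\<Phi>"
    by (simp add: surj_shear_lift)
  then have cont: "isCont ?\<Phi> y"
    by (simp add: continuous_on_eq_continuous_at)
  interpret d: bounded_linear ?d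
    by (rule has_derivative_bounded_linear[OF torus_Ck_fun_has_derivative[OF v]])
  show ?thesis
  proof (rule has_derivative_inverse_basic[OF shear_lift_has_derivative[OF v] _ _ cont open_UNIV UNIV_I])
    show "bounded_linear (\<lambda>h. h - (?d h * (1 + ?d w) powr (- 1)) *\<^sub>R w)"
      by (rule bounded_linear_sub[OF bounded_linear_ident bounded_linear_compose[OF
            bounded_linear_scaleR_left bounded_linear_compose[OF bounded_linear_mult_left
            d.bounded_linear_axioms]]])
    show "(\<lambda>h. h - (?d h * (1 + ?d w) powr (- 1)) *\<^sub>R w) \<circ> (\<lambda>h. h + ?d h *\<^sub>R w) = id"
    proof (rule ext)
      fix h
      have "?d (h + ?d h *\<^sub>R w) = ?d h * (1 + ?d w)"
        by (simp add: d.add d.scaleR distrib_left)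
      then show "((\<lambda>h. h - (?d h * (1 + ?d w) powr (- 1)) *\<^sub>R w) \<circ> (\<lambda>h. h + ?d h *\<^sub>R w)) h = id h"
        using pos[of "to_torus (?\<Phi> y)"] by (simp add: powr_minus)
    qed
    show "shear_lift v w (?\<Phi> z) = z" for z
      by (rule surj_f_inv_f[OF surj_shear_lift])
  qed
qed

lemma Ck_shear_lift: "Ck_on (Suc k) (shear_lift v w) UNIV"
  unfolding shear_lift_def using v unfolding torus_Ck_fun_def
  by (intro Ck_on_add[OF Ck_on_linear[OF bounded_linear_ident]] Ck_on_scaleR[OF _ Ck_on_const])

text \<open>
  Bootstrapping: the derivative of the inverse \<open>\<Phi>\<close> is a \<open>C\<^sup>k\<close> function composed with \<open>\<Phi>\<close>, so if
  \<open>\<Phi>\<close> is \<open>C\<^sup>j\<close> for some \<open>j \<le> k\<close>, then it is \<open>C\<^bsup>j+1\<^esup>\<close>.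
\<close>

lemma Ck_inv_shear_lift: "Ck_on (Suc k) (inv (shear_lift v w)) UNIV"
proof -
  let ?\<Phi> = "inv (shear_lift v w)"
  have "Ck_on j ?\<Phi> UNIV" if "j \<le> Suc k" for j
    using that
  proof (induction j)
    case 0
    have "continuous_on UNIV ?\<Phi>"
      using has_derivative_continuous[OF inv_shear_lift_has_derivative]
      by (simp add: continuous_on_eq_continuous_at)
    then show ?case by simp
  next
    case (Suc j)
    then have \<Phi>: "Ck_on j ?\<Phi> UNIV" and "j \<le> k" by auto
    have d: "Ck_on j (\<lambda>x. torus_deriv v h (to_torus x)) UNIV" for h
      using torus_Ck_fun_mono[OF torus_Ck_fun_deriv[OF v] \<open>j \<le> k\<close>] by (simp add: torus_Ck_fun_def)
    show ?case
    proof (rule Ck_on_SucI[OF inv_shear_lift_has_derivative])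
      fix h
      have "Ck_on j (\<lambda>x. torus_deriv v h (to_torus x) * (1 + torus_deriv v w (to_torus x)) powr (- 1)) UNIV"
        by (intro Ck_on_mult d Ck_on_powr pos Ck_on_add Ck_on_const)
      from Ck_on_compose[OF this \<Phi>]
      show "Ck_on j (\<lambda>y. h - (torus_deriv v h (to_torus (?\<Phi> y)) *
          (1 + torus_deriv v w (to_torus (?\<Phi> y))) powr (- 1)) *\<^sub>R w) UNIV"
        by (intro Ck_on_diff Ck_on_scaleR Ck_on_const)
    qed
  qed
  then show ?thesis by blast
qed

text \<open>
  The lift commutes with lattice translations, so its bijectivity descends to the torus.
\<close>

lemma bij_shear: "bij (shear v w)"
proof (rule bijI)
  show "inj (shear v w)"
  proof (rule injI)
    fix \<theta> \<phi> assume eq: "shear v w \<theta> = shear v w \<phi>"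
    have "to_torus (shear_lift v w (rep_torus \<theta>)) = to_torus (shear_lift v w (rep_torus \<phi>))"
      using eq by (simp flip: shear_to_torus)
    then obtain k where "shear_lift v w (rep_torus \<theta>)
        = shear_lift v w (rep_torus \<phi> + (2 * pi) *\<^sub>R int_vec k)"
      unfolding to_torus_eq_iff shear_lift_periodic by blast
    then have "rep_torus \<theta> = rep_torus \<phi> + (2 * pi) *\<^sub>R int_vec k"
      by (rule injD[OF inj_shear_lift])
    then show "\<theta> = \<phi>"
      by (metis to_torus_periodic to_torus_rep)
  qed
  show "surj (shear v w)"
    by (rule surjI[of _ "\<lambda>\<phi>. to_torus (inv (shear_lift v w) (rep_torus \<phi>))"])
       (simp add: shear_to_torus surj_f_inv_f[OF surj_shear_lift])
qed

lemma shear_diffeo: "torus_Ck_diffeo (Suc k) (shear v w)"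
proof -
  have "inv (shear v w) (to_torus y) = to_torus (inv (shear_lift v w) y)" for y
    by (rule inv_f_eq[OF bij_is_inj[OF bij_shear]])
       (simp add: shear_to_torus surj_f_inv_f[OF surj_shear_lift])
  then show ?thesis
    unfolding torus_Ck_diffeo_def torus_Ck_map_def
    using bij_shear Ck_shear_lift Ck_inv_shear_lift shear_to_torus[of v w] open_UNIV UNIV_I by blast
qed

end

lemma shear_velocity:
  assumes v: "torus_Ck_fun (Suc k) v" and vel: "torus_has_velocity c (s *\<^sub>R w) t J" and "t \<in> J"
  shows "torus_has_velocity (\<lambda>u. shear v w (c u)) ((s * (1 + torus_deriv v w (c t))) *\<^sub>R w) t J"
proof -
  obtain x d where d: "0 < d" "\<And>u. u \<in> J \<Longrightarrow> \<bar>u - t\<bar> < d \<Longrightarrow> c u = to_torus (x u)"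
    and x: "(x has_vector_derivative s *\<^sub>R w) (at t within J)"
    using vel unfolding torus_has_velocity_def by blast
  have ct: "c t = to_torus (x t)"
    using d \<open>t \<in> J\<close> by simp
  note D = shear_lift_has_derivative[OF v, of w "x t"]
  have "((\<lambda>u. shear_lift v w (x u)) has_vector_derivative
      (s *\<^sub>R w + torus_deriv v (s *\<^sub>R w) (c t) *\<^sub>R w)) (at t within J)"
    using vector_derivative_diff_chain_within[OF x has_derivative_at_withinI[OF D]] by (simp add: o_def ct)
  moreover have "torus_deriv v (s *\<^sub>R w) (c t) = s * torus_deriv v w (c t)"
    using linear_scale[OF has_derivative_linear[OF torus_Ck_fun_has_derivative[OF v, of "x t"]], of s w]
    by (simp add: ct)
  ultimately have "((\<lambda>u. shear_lift v w (x u)) has_vector_derivative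
      (s * (1 + torus_deriv v w (c t))) *\<^sub>R w) (at t within J)"
    by (simp add: algebra_simps)
  then show ?thesis
    unfolding torus_has_velocity_def using d
    by (intro exI[of _ "\<lambda>u. shear_lift v w (x u)"] exI[of _ d]) (simp add: shear_to_torus)
qed

lemma scale_measure_eq_density: "scale_measure c M = density M (\<lambda>_. c)"
  by (rule measure_eqI) (simp_all add: emeasure_density_const)

text \<open>
  Let \<open>e\<^sub>n\<close> be a nonconstant character and \<open>S\<close> the shear. The derivative of \<open>e\<^sub>n \<circ> S\<close> in the direction
  \<open>w\<close> is \<open>\<i> (n \<cdot> w) (1 + w \<cdot> \<nabla>v) (e\<^sub>n \<circ> S) = \<i> (n \<cdot> w) A \<rho> (e\<^sub>n \<circ> S)\<close>. As derivatives have integral zero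
  and \<open>n \<cdot> w \<noteq> 0\<close>, the \<open>n\<close>-th Fourier coefficient of the pushforward vanishes, as does that of
  Lebesgue measure. The total masses agree because \<open>A \<rho> = 1 + w \<cdot> \<nabla>v\<close> has mean one. Hence the two
  measures have the same Fourier coefficients.
\<close>

lemma shear_pushforward:
  fixes v \<rho> :: "'n::finite torus \<Rightarrow> real"
  assumes v: "torus_Ck_fun (Suc 0) v" and \<rho>: "continuous_on UNIV \<rho>" "\<And>\<theta>. 0 \<le> \<rho> \<theta>"
    and "0 < A" and flow: "\<And>\<theta>. 1 + torus_deriv v w \<theta> = A * \<rho> \<theta>"
    and nonres: "\<And>n. n \<noteq> 0 \<Longrightarrow> int_vec n \<bullet> w \<noteq> 0"
  shows "distr (density torus_lebesgue (\<lambda>\<theta>. ennreal (\<rho> \<theta>))) borel (shear v w)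
    = scale_measure (ennreal (1 / A)) torus_lebesgue"
proof (rule torus_measure_eqI)
  have vc: "continuous_on UNIV v" using v by (rule torus_Ck_fun_continuous)
  have dc: "continuous_on UNIV (torus_deriv v h)" for h
    using torus_Ck_fun_deriv[OF v] by (simp add: torus_Ck_fun_0)
  have "continuous_on UNIV (\<lambda>x. shear v w (to_torus x))"
    unfolding shear_to_torus shear_lift_def
    using vc unfolding continuous_on_torus_iff[of v]
    by (intro continuous_on_compose2[OF continuous_on_to_torus] continuous_intros) auto
  then have sc: "continuous_on UNIV (shear v w)"
    by (simp add: continuous_on_torus_iff)
  have [measurable]: "shear v w \<in> borel_measurable borel" "\<rho> \<in> borel_measurable borel"
    "torus_char n \<in> borel_measurable borel" for n :: "int ^ 'n"
    by (intro borel_measurable_continuous_onI sc \<rho> continuous_on_torus_char)+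
  have int\<rho>: "integrable torus_lebesgue \<rho>"
    by (rule integrable_torus_continuous[OF \<rho>(1)])
  have "emeasure (density torus_lebesgue (\<lambda>\<theta>. ennreal (\<rho> \<theta>))) UNIV = (\<integral>\<^sup>+\<theta>. ennreal (\<rho> \<theta>) \<partial>torus_lebesgue)"
    by (subst emeasure_density) auto
  also have "\<dots> < \<infinity>"
    using int\<rho> \<rho>(2) by (simp add: nn_integral_eq_integral)
  finally have fin: "finite_measure (density torus_lebesgue (\<lambda>\<theta>. ennreal (\<rho> \<theta>)))"
    by (intro finite_measureI) simp
  show "finite_measure (distr (density torus_lebesgue (\<lambda>\<theta>. ennreal (\<rho> \<theta>))) borel (shear v w))"
    by (rule finite_measure.finite_measure_distr[OF fin]) simp
  show "finite_measure (scale_measure (ennreal (1 / A)) (torus_lebesgue :: 'n torus measure))"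
    by (intro finite_measureI) (simp add: space_scale_measure emeasure_torus_UNIV ennreal_mult_eq_top_iff)
  fix n :: "int ^ 'n"
  let ?G = "\<lambda>\<theta>. torus_char n (shear v w \<theta>)"
  have lhs: "(LINT \<theta>|distr (density torus_lebesgue (\<lambda>\<theta>. ennreal (\<rho> \<theta>))) borel (shear v w). torus_char n \<theta>)
      = (LINT \<theta>|torus_lebesgue. \<rho> \<theta> *\<^sub>R ?G \<theta>)"
    by (subst integral_distr; simp?) (subst integral_density; simp add: \<rho>)
  have rhs: "(LINT \<theta>|scale_measure (ennreal (1 / A)) torus_lebesgue. torus_char n \<theta>)
      = (1 / A) *\<^sub>R (LINT \<theta>|torus_lebesgue. torus_char n \<theta>)"
    unfolding scale_measure_eq_density
    by (subst integral_density) (use \<open>0 < A\<close> in auto)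
  have Gc: "continuous_on UNIV ?G"
    by (rule continuous_on_compose2[OF continuous_on_torus_char sc]) simp
  let ?G' = "\<lambda>h \<theta>. \<i> * of_real (int_vec n \<bullet> h + torus_deriv v h \<theta> * (int_vec n \<bullet> w)) * ?G \<theta>"
  have G': "((\<lambda>x. ?G (to_torus x)) has_derivative (\<lambda>h. ?G' h (to_torus x))) (at x)" for x
  proof -
    have "((\<lambda>x. cis (int_vec n \<bullet> shear_lift v w x)) has_derivative
        (\<lambda>h. \<i> * of_real (int_vec n \<bullet> (h + torus_deriv v h (to_torus x) *\<^sub>R w)) *
          cis (int_vec n \<bullet> shear_lift v w x))) (at x)"
      by (rule has_derivative_compose[OF shear_lift_has_derivative[OF v] has_derivative_cis_inner])
    then show ?thesis
      by (simp add: shear_to_torus torus_char_to_torus inner_add_right)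
  qed
  have G1: "torus_Ck_fun (Suc 0) ?G"
  proof (rule torus_Ck_fun_SucI[OF G'])
    show "torus_Ck_fun 0 (?G' h)" for h
      unfolding torus_Ck_fun_0
      by (intro continuous_on_mult continuous_on_const continuous_on_of_real continuous_on_add dc Gc)
  qed
  have dG: "torus_deriv ?G w \<theta> = (\<i> * of_real ((int_vec n \<bullet> w) * A)) * (\<rho> \<theta> *\<^sub>R ?G \<theta>)" for \<theta>
  proof -
    have "torus_deriv ?G w \<theta> = ?G' w \<theta>"
      using torus_deriv_eqI[OF G', of w "rep_torus \<theta>"] by simp
    also have "int_vec n \<bullet> w + torus_deriv v w \<theta> * (int_vec n \<bullet> w) = (int_vec n \<bullet> w) * (A * \<rho> \<theta>)"
      by (simp add: algebra_simps flip: flow)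
    finally show ?thesis by (simp add: scaleR_conv_of_real mult_ac)
  qed
  show "(LINT \<theta>|distr (density torus_lebesgue (\<lambda>\<theta>. ennreal (\<rho> \<theta>))) borel (shear v w). torus_char n \<theta>)
      = (LINT \<theta>|scale_measure (ennreal (1 / A)) torus_lebesgue. torus_char n \<theta>)"
  proof (cases "n = 0")
    case False
    have "(\<i> * of_real ((int_vec n \<bullet> w) * A)) * (LINT \<theta>|torus_lebesgue. \<rho> \<theta> *\<^sub>R ?G \<theta>) = 0"
      using integral_torus_deriv[OF G1, of w]
      by (simp only: dG Bochner_Integration.integral_mult_right_zero)
    then have "(LINT \<theta>|torus_lebesgue. \<rho> \<theta> *\<^sub>R ?G \<theta>) = 0"
      using nonres[OF False] \<open>0 < A\<close> by simp
    then show ?thesis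
      using False by (simp add: lhs rhs integral_torus_char)
  next
    case True
    have cv: "torus_Ck_fun (Suc 0) (\<lambda>\<theta>. complex_of_real (v \<theta>))"
      by (rule torus_Ck_fun_linear_comp[OF bounded_linear_of_real v])
    have "(LINT \<theta>|torus_lebesgue. complex_of_real (torus_deriv v w \<theta>)) = 0"
      using integral_torus_deriv[OF cv, of w]
      by (simp add: torus_deriv_linear_comp[OF bounded_linear_of_real v])
    then have "(LINT \<theta>|torus_lebesgue. torus_deriv v w \<theta>) = 0"
      by (simp only: integral_complex_of_real of_real_eq_0_iff)
    then have "(2 * pi) ^ CARD('n) = (LINT \<theta>|torus_lebesgue. 1 + torus_deriv v w \<theta>)"
      by (simp add: integrable_torus_continuous dc measure_torus_UNIV)
    also have "\<dots> = A * (LINT \<theta>|torus_lebesgue. \<rho> \<theta>)"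
      by (simp add: flow)
    finally have "(LINT \<theta>|torus_lebesgue. \<rho> \<theta>) = (1 / A) * (2 * pi) ^ CARD('n)"
      using \<open>0 < A\<close> by (simp add: field_simps)
    moreover have "(LINT \<theta>|torus_lebesgue. \<rho> \<theta> *\<^sub>R ?G \<theta>) = of_real (LINT \<theta>|torus_lebesgue. \<rho> \<theta>)"
      unfolding True by (simp add: scaleR_conv_of_real integral_complex_of_real)
    ultimately show ?thesis
      unfolding lhs rhs by (simp add: True integral_torus_char scaleR_conv_of_real)
  qed
qed simp_all


section \<open>The weighted Hamiltonian flow\<close>

lemma v_series_eq_trig_series:
  "v_series m w = trig_series (small_divisor_coeff (\<lambda>\<theta>. complex_of_real (weight_b m \<theta>)) w)"
  unfolding v_series_def trig_series_def
  by (intro ext infsum_cong_neutral) (auto simp: small_divisor_coeff_def)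

lemma conjugacy_eq_shear: "conjugacy m w = shear (v_sol m w) w"
  by (simp add: conjugacy_def shear_def fun_eq_iff)

context
  fixes m :: "'n::finite torus \<Rightarrow> real" and q :: nat
  assumes m: "torus_Ck_fun q m" and m_pos: "\<And>\<theta>. 0 < m \<theta>"
begin

lemma weight_rho_Ck: "torus_Ck_fun q (weight_rho m)"
  using m m_pos unfolding torus_Ck_fun_def weight_rho_def by (intro Ck_on_powr)

lemma weight_rho_pos: "0 < weight_rho m \<theta>"
  using m_pos[of \<theta>] by (simp add: weight_rho_def)

lemma weight_a_rho: "weight_a m \<theta> * weight_rho m \<theta> = 1"
  using m_pos[of \<theta>] by (simp add: weight_a_def weight_rho_def flip: powr_add)

lemma weight_b_eq: "weight_b m \<theta> = a_bar m * weight_rho m \<theta> - 1"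
  using m_pos[of \<theta>] by (simp add: weight_b_def weight_a_def weight_rho_def powr_minus_divide)

lemma integral_weight_rho_pos: "0 < (LINT \<theta>|torus_lebesgue. weight_rho m \<theta>)"
proof (rule ccontr)
  assume "\<not> 0 < (LINT \<theta>|torus_lebesgue. weight_rho m \<theta>)"
  moreover have "0 \<le> (LINT \<theta>|torus_lebesgue. weight_rho m \<theta>)"
    by (rule integral_nonneg_AE) (simp add: weight_rho_pos less_imp_le)
  ultimately have "(LINT \<theta>|torus_lebesgue. weight_rho m \<theta>) = 0" by simp
  from integral_torus_nonneg_eq_0[OF torus_Ck_fun_continuous[OF weight_rho_Ck] less_imp_le[OF weight_rho_pos] this]
  show False using weight_rho_pos by (metis less_irrefl)
qed

lemma a_bar_pos: "0 < a_bar m"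
  using integral_weight_rho_pos by (simp add: a_bar_def)

lemma weight_b_Ck: "torus_Ck_fun q (\<lambda>\<theta>. complex_of_real (weight_b m \<theta>))"
  using weight_rho_Ck unfolding torus_Ck_fun_def weight_b_eq
  by (intro Ck_on_linear_comp[OF bounded_linear_of_real] Ck_on_diff Ck_on_mult Ck_on_const)

lemma weight_b_mean_zero: "torus_fourier (\<lambda>\<theta>. complex_of_real (weight_b m \<theta>)) 0 = 0"
proof -
  have "(LINT \<theta>|torus_lebesgue. weight_b m \<theta>)
      = a_bar m * (LINT \<theta>|torus_lebesgue. weight_rho m \<theta>) - (2 * pi) ^ CARD('n)"
    using integrable_torus_continuous[OF torus_Ck_fun_continuous[OF weight_rho_Ck]]
    by (simp add: weight_b_eq measure_torus_UNIV)
  also have "\<dots> = 0"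
    using integral_weight_rho_pos by (simp add: a_bar_def)
  finally show ?thesis
    by (simp add: torus_fourier_def integral_complex_of_real)
qed

end

theorem theorem3p1:
  fixes \<Omega> :: "(real ^ 'n) set"
    and H :: "real ^ 'n \<Rightarrow> real"
    and \<omega> :: "real ^ 'n \<Rightarrow> real ^ 'n"
    and m :: "'n torus \<Rightarrow> real"
    and q r :: nat
    and \<alpha> \<tau> :: real
  assumes "bounded_lipschitz_domain \<Omega>"
    and "Ck_on 2 H \<Omega>"
    and "\<And>I. I \<in> \<Omega> \<Longrightarrow> GDERIV H I :> \<omega> I"
    and "torus_Ck_fun q m"
    and "\<And>\<theta>. 0 < m \<theta>"
    and "2 * CARD('n) < q"
    and "\<tau> + real CARD('n) + 1 \<le> real q"
    and "0 < \<alpha>"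
    and "2 * (real CARD('n) - 1) < 2 * \<tau>"
    and "2 * \<tau> \<le> real q - real CARD('n) - 1"
    and "\<And>I n. I \<in> \<Omega> \<Longrightarrow> n \<noteq> 0 \<Longrightarrow>
           \<alpha> * norm (int_vec n) powr (- \<tau>) \<le> \<bar>int_vec n \<bullet> \<omega> I\<bar>"
    and "1 \<le> r"
    and "real r < real q - \<tau> - real CARD('n)"
  shows "\<forall>I\<in>\<Omega>.
     torus_Ck_diffeo r (conjugacy m (\<omega> I)) \<and>
     (\<forall>J \<theta>. is_interval J \<longrightarrow>
        (\<forall>t\<in>J. torus_has_velocity \<theta> (weight_a m (\<theta> t) *\<^sub>R \<omega> I) t J) \<longrightarrow>
        (\<forall>t\<in>J. torus_has_velocity (\<lambda>s. conjugacy m (\<omega> I) (\<theta> s)) (a_bar m *\<^sub>R \<omega> I) t J)) \<and>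
     distr (density torus_lebesgue (\<lambda>\<theta>. ennreal (weight_rho m \<theta>))) borel (conjugacy m (\<omega> I))
       = scale_measure (ennreal (1 / a_bar m)) torus_lebesgue"
proof
  fix I assume I: "I \<in> \<Omega>"
  define w where "w = \<omega> I"
  define v where "v = v_sol m w"
  note m = assms(4,5)
  have dioph: "\<And>n. n \<noteq> 0 \<Longrightarrow> \<alpha> * norm (int_vec n) powr (- \<tau>) \<le> \<bar>int_vec n \<bullet> w\<bar>"
    unfolding w_def by (rule assms(11)[OF I])
  obtain k where r: "r = Suc k"
    using \<open>1 \<le> r\<close> by (cases r) auto
  have v_eq: "v = (\<lambda>\<theta>. Re (v_series m w \<theta>))"
    by (simp add: v_def v_sol_def fun_eq_iff)
  note cohom = cohomological_equation[OF weight_b_Ck[OF m] weight_b_mean_zero[OF m] \<open>0 < \<alpha>\<close> dioph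
      assms(12,13), folded v_series_eq_trig_series]
  have v: "torus_Ck_fun (Suc k) v"
    unfolding v_eq using cohom(1) by (simp add: r torus_Ck_fun_linear_comp bounded_linear_Re)
  have "torus_deriv v w \<theta> = weight_b m \<theta>" for \<theta>
    unfolding v_eq using torus_deriv_linear_comp[OF bounded_linear_Re cohom(1)[unfolded r]] cohom(2) by simp
  then have flow: "1 + torus_deriv v w \<theta> = a_bar m * weight_rho m \<theta>" for \<theta>
    by (simp add: weight_b_eq[OF m])
  have pos: "0 < 1 + torus_deriv v w \<theta>" for \<theta>
    unfolding flow using a_bar_pos[OF m] weight_rho_pos[OF m] by simp
  have "torus_Ck_diffeo r (shear v w)"
    unfolding r by (rule shear_diffeo[OF v pos])
  moreover have "torus_has_velocity (\<lambda>s. shear v w (\<theta> s)) (a_bar m *\<^sub>R w) t J"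
    if "torus_has_velocity \<theta> (weight_a m (\<theta> t) *\<^sub>R w) t J" "t \<in> J" for \<theta> t J
  proof -
    have "weight_a m (\<theta> t) * (1 + torus_deriv v w (\<theta> t)) = a_bar m"
      using weight_a_rho[OF m, of "\<theta> t"] by (simp add: flow mult.left_commute)
    then show ?thesis
      using shear_velocity[OF v that] by simp
  qed
  moreover have "distr (density torus_lebesgue (\<lambda>\<theta>. ennreal (weight_rho m \<theta>))) borel (shear v w)
      = scale_measure (ennreal (1 / a_bar m)) torus_lebesgue"
  proof (rule shear_pushforward[OF torus_Ck_fun_mono[OF v] _ _ a_bar_pos[OF m] flow])
    show "int_vec n \<bullet> w \<noteq> 0" if n: "n \<noteq> 0" for n
      by (rule diophantine_imp_nonresonant[OF \<open>0 < \<alpha>\<close> dioph[OF n] n])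
  qed (auto intro: torus_Ck_fun_continuous weight_rho_Ck[OF m] less_imp_le weight_rho_pos[OF m])
  ultimately show "torus_Ck_diffeo r (conjugacy m (\<omega> I)) \<and>
     (\<forall>J \<theta>. is_interval J \<longrightarrow>
        (\<forall>t\<in>J. torus_has_velocity \<theta> (weight_a m (\<theta> t) *\<^sub>R \<omega> I) t J) \<longrightarrow>
        (\<forall>t\<in>J. torus_has_velocity (\<lambda>s. conjugacy m (\<omega> I) (\<theta> s)) (a_bar m *\<^sub>R \<omega> I) t J)) \<and>
     distr (density torus_lebesgue (\<lambda>\<theta>. ennreal (weight_rho m \<theta>))) borel (conjugacy m (\<omega> I))
       = scale_measure (ennreal (1 / a_bar m)) torus_lebesgue"
    by (simp add: conjugacy_eq_shear flip: v_def w_def)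
qed

end
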